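(* Let $\nu,\alpha,\beta\in\mathbb{R}$ with $\alpha>-1-2\nu$ and $\beta>-1$. Let $f(z)=z^{\nu}F(z)$ belong to the class $\mathcal{B}$ (defined in the context), let $\lambda_n$, $n=1,2,\dots$, be the zeros of $F$, and suppose that $$\int_0^1 f(\lambda_n t)f(\lambda_m t)\,t^{\alpha}(1-t)^{\beta}\,dt=0\qquad\text{whenever } n\neq m .$$ Then $f$ satisfies the integral equation $$a\int_0^z u^{\nu+\alpha+1}(z-u)^{\beta}f(u)\,du=(az+1)\int_0^z u^{\nu+\alpha}(z-u)^{\beta}f(u)\,du+z^{\nu+\alpha+\beta+1}f(z)\,A,$$ where $a=F'(0)$ and $A=-B(2\nu+\alpha+1,\beta+1)$, with $B$ the Euler Beta function.
   Context: Class $\mathcal{B}$: let $\nu,\alpha\in\mathbb{R}$ with $2\nu+\alpha>-1$. A function $f(z)=z^{\nu}F(z)$ is said to belong to the class $\mathcal{B}$ if $F$ is an entire function with $F(0)=1$, of order less than one or of order one and minimal type, whose zeros $\lambda_n$, $n=1,2,\dots$, are real (not necessarily positive) and satisfy $\sum_n|\lambda_n|^{-1}<\infty$. Conventions: $\int_0^z$ is taken along the segment $u=zt$, $0\le t\le 1$, with powers interpreted consistently, so that $u^{s}=z^{s}t^{s}$ and $(z-u)^{\beta}=z^{\beta}(1-t)^{\beta}$; $z^{\nu}$ denotes a fixed branch of the power. *)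

theory Defs
  imports "HOL-Complex_Analysis.Complex_Analysis"
begin

(* A choice L of the logarithm off the origin that is compatible with rescaling along rays, so
   that the powers exp (s * L z) satisfy (z * t)^s = z^s * t^s for t > 0. No continuity across
   rays is required: any ray may serve as the branch cut. *)
definition log_branch :: "(complex \<Rightarrow> complex) \<Rightarrow> bool" where
  "log_branch L \<longleftrightarrow>
     (\<forall>z. z \<noteq> 0 \<longrightarrow> exp (L z) = z) \<and>
     (\<forall>z t. z \<noteq> 0 \<longrightarrow> t > 0 \<longrightarrow> L (z * of_real t) = L z + of_real (ln t))"

lemma log_branch_Ln: "log_branch Ln"
  unfolding log_branch_def using Ln_times_of_real by (auto simp: Ln_of_real mult.commute add.commute)

(* The power z^s for the branch L; its value at z = 0 carries no meaning. *)
definition branch_pow :: "(complex \<Rightarrow> complex) \<Rightarrow> real \<Rightarrow> complex \<Rightarrow> complex" where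
  "branch_pow L s z = exp (of_real s * L z)"

lemma branch_pow_scale:
  assumes "log_branch L" "z \<noteq> 0" "t > 0"
  shows "branch_pow L s (z * of_real t) = branch_pow L s z * of_real (t powr s)"
  using assms
  by (simp add: log_branch_def branch_pow_def powr_def distrib_left exp_add exp_of_real [symmetric])

definition max_modulus :: "(complex \<Rightarrow> complex) \<Rightarrow> real \<Rightarrow> real" where
  "max_modulus F r = (SUP z\<in>sphere 0 r. norm (F z))"

(* Constant functions get order 0, since the inner logarithm is then constant. *)
definition entire_order :: "(complex \<Rightarrow> complex) \<Rightarrow> ereal" where
  "entire_order F = Limsup at_top (\<lambda>r::real. ereal (ln (ln (max_modulus F r)) / ln r))"

definition entire_type :: "real \<Rightarrow> (complex \<Rightarrow> complex) \<Rightarrow> ereal" where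
  "entire_type \<rho> F = Limsup at_top (\<lambda>r::real. ereal (ln (max_modulus F r) / r powr \<rho>))"

(* The sequence lists all zeros of F, each as often as its multiplicity; zorder F z = 0 when
   F z is nonzero. Since card of an infinite set is 0, finiteness has to be required. *)
definition enumerates_zeros :: "(complex \<Rightarrow> complex) \<Rightarrow> (nat \<Rightarrow> complex) \<Rightarrow> bool" where
  "enumerates_zeros F zs \<longleftrightarrow>
     (\<forall>z. finite {n. zs n = z} \<and> int (card {n. zs n = z}) = zorder F z)"

(* f(z) = z^\<nu> F(z) belongs to the class B, the zeros of F being the sequence zs (indexed
   from 0). As z^\<nu> may be singular at 0, the value f 0 is left unconstrained. *)
definition class_B ::
  "(complex \<Rightarrow> complex) \<Rightarrow> real \<Rightarrow> (complex \<Rightarrow> complex) \<Rightarrow> (complex \<Rightarrow> complex) \<Rightarrow> (nat \<Rightarrow> complex) \<Rightarrow> bool" where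
  "class_B L \<nu> f F zs \<longleftrightarrow>
     (\<forall>z. z \<noteq> 0 \<longrightarrow> f z = branch_pow L \<nu> z * F z) \<and>
     F holomorphic_on UNIV \<and> F 0 = 1 \<and>
     (entire_order F < 1 \<or> entire_order F = 1 \<and> entire_type 1 F = 0) \<and>
     enumerates_zeros F zs \<and>
     (\<forall>n. zs n \<in> \<real>) \<and>
     summable (\<lambda>n. inverse (norm (zs n)))"

end

theory Submission
  imports Defs "HOL-Real_Asymp.Real_Asymp"
begin

text \<open>
  Put \<open>w t = t powr (2 * \<nu> + \<alpha>) * (1 - t) powr \<beta>\<close>. On the ray through \<open>z\<close> all powers of \<open>z\<close> factor out, so the
  claim says \<open>a * z * K1 z = (a * z + 1) * K0 z + A * F z\<close> for the weighted means
  \<open>K0 z = \<integral> F (z * t) * w t dt\<close> and \<open>K1 z = \<integral> t * F (z * t) * w t dt\<close> over \<open>{0..1}\<close>.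

  The engine is a uniqueness principle for combinations
  \<open>D z = z * \<integral> F (z * t) * \<phi> t dt + \<integral> F (z * t) * \<psi> t dt\<close>: if \<open>D\<close> vanishes at all zeros of \<open>F\<close>, and these
  are real and simple, then \<open>D = D 0 * F\<close> (lemma \<open>averaged_vanishing_at_zeros\<close>). Indeed \<open>F\<close> equals its
  canonical product \<open>\<Prod>(1 - z / \<lambda>\<^sub>n)\<close> (\<open>hadamard_genus_zero\<close>), so \<open>\<bar>F\<bar>\<close> increases along the imaginary
  axis and \<open>F (\<i> * y * t) / F (\<i> * y)\<close> tends to 0 for \<open>t < 1\<close>. Hence \<open>H = D / F\<close> is \<open>o(y)\<close> there. Like
  \<open>F\<close>, the quotient grows more slowly than every \<open>exp (\<epsilon> * \<bar>z\<bar>)\<close> (\<open>min_exp_type_quotient\<close>), and an entire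
  function of such growth that is bounded on a line is constant
  (\<open>min_exp_type_bounded_on_reals_imp_constant\<close>). Applied to \<open>(H z - H 0) / z\<close> this makes \<open>H\<close> affine,
  and the \<open>o(y)\<close> bound removes the linear term.

  The principle is used twice. For a fixed zero \<open>\<lambda>\<close>, orthogonality says that
  \<open>g z = \<integral> F (\<lambda> * t) * F (z * t) * w t dt\<close> vanishes at all other zeros, so
  \<open>(1 - z / \<lambda>) * g z = K0 \<lambda> * F z\<close>; the coefficient of \<open>z\<close> in this identity is
  \<open>a * \<lambda> * K1 \<lambda> = (a * \<lambda> + 1) * K0 \<lambda>\<close>. Therefore \<open>a * z * K1 z - (a * z + 1) * K0 z\<close> vanishes at every zero,
  and the principle identifies it with \<open>- K0 0 * F z = A * F z\<close>.

  Simplicity of the zeros is also a consequence of orthogonality: if \<open>\<lambda>\<close> were listed twice, then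
  \<open>\<integral> (F (\<lambda> * t))\<^sup>2 * w t dt\<close> would be 0 although \<open>F\<close> is real on the real axis and \<open>F 0 = 1\<close>.
\<close>

section \<open>Entire functions of minimal exponential type\<close>

text \<open>
  One predicate for "order less than one, or order one and minimal type". The quantifier form is
  easier to work with than the upper limits defining order and type: it is preserved by sums, by
  products with polynomials, by differentiation and by passing to means of \<open>F (z * t)\<close>.
\<close>
definition min_exp_type :: "(complex \<Rightarrow> complex) \<Rightarrow> bool" where
  "min_exp_type h \<longleftrightarrow> (\<forall>\<epsilon>>0. \<exists>C. \<forall>z. norm (h z) \<le> C * exp (\<epsilon> * norm z))"

lemma min_exp_typeD:
  assumes "min_exp_type h" "\<epsilon> > 0"
  obtains C where "C \<ge> 1" "\<And>z. norm (h z) \<le> C * exp (\<epsilon> * norm z)"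
proof -
  obtain C where C: "\<And>z. norm (h z) \<le> C * exp (\<epsilon> * norm z)"
    using assms unfolding min_exp_type_def by blast
  have "norm (h z) \<le> max C 1 * exp (\<epsilon> * norm z)" for z
    by (rule order_trans[OF C mult_right_mono]) auto
  thus ?thesis
    using that[of "max C 1"] by simp
qed

lemma min_exp_typeI_outside:
  assumes cont: "continuous_on UNIV h"
    and outside: "\<And>\<epsilon>. \<epsilon> > 0 \<Longrightarrow> \<exists>C R. \<forall>z. norm z \<ge> R \<longrightarrow> norm (h z) \<le> C * exp (\<epsilon> * norm z)"
  shows "min_exp_type h"
  unfolding min_exp_type_def
proof (intro allI impI)
  fix \<epsilon> :: real assume "\<epsilon> > 0"
  then obtain C R where CR: "\<And>z. norm z \<ge> R \<Longrightarrow> norm (h z) \<le> C * exp (\<epsilon> * norm z)"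
    using outside by blast
  have "compact (h ` cball 0 R)"
    by (intro compact_continuous_image continuous_on_subset[OF cont]) auto
  then obtain B where "\<forall>w\<in>h ` cball 0 R. norm w \<le> B"
    using compact_imp_bounded bounded_iff by metis
  hence B: "norm (h z) \<le> B" if "norm z \<le> R" for z
    using that by simp
  have "norm (h z) \<le> max \<bar>B\<bar> C * exp (\<epsilon> * norm z)" for z
  proof (cases "norm z \<ge> R")
    case True
    show ?thesis
      by (rule order_trans[OF CR[OF True] mult_right_mono]) auto
  next
    case False
    have "norm (h z) \<le> \<bar>B\<bar> * 1"
      using B[of z] False by simp
    also have "\<dots> \<le> max \<bar>B\<bar> C * exp (\<epsilon> * norm z)"
      using \<open>\<epsilon> > 0\<close> by (intro mult_mono) auto
    finally show ?thesis .
  qed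
  thus "\<exists>C. \<forall>z. norm (h z) \<le> C * exp (\<epsilon> * norm z)" by blast
qed

text \<open>
  In the first case \<open>ln (max_modulus F r)\<close> is at most \<open>r powr c\<close> with \<open>c < 1\<close>, in the second it is at most
  \<open>\<epsilon> * r\<close>. The iterated logarithm carries information only where \<open>max_modulus F r > 1\<close>; at all other
  radii the bound is trivial.
\<close>
lemma order_type_imp_min_exp_type:
  assumes hol: "F holomorphic_on UNIV"
    and growth: "entire_order F < 1 \<or> entire_order F = 1 \<and> entire_type 1 F = 0"
  shows "min_exp_type F"
proof (rule min_exp_typeI_outside)
  show cont: "continuous_on UNIV F"
    using hol by (rule holomorphic_on_imp_continuous_on)
  fix \<epsilon> :: real assume eps: "\<epsilon> > 0"
  have le_max: "norm (F z) \<le> max_modulus F (norm z)" for z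
    unfolding max_modulus_def
    by (intro cSUP_upper bounded_imp_bdd_above compact_imp_bounded compact_continuous_image
        continuous_intros continuous_on_subset[OF cont]) auto
  have "eventually (\<lambda>r. max_modulus F r \<le> exp (\<epsilon> * r)) at_top"
    using growth
  proof
    assume "entire_order F < 1"
    then obtain c where c: "entire_order F < ereal c" "ereal c < ereal 1"
      using ereal_dense2 by (metis one_ereal_def)
    have "eventually (\<lambda>r. ereal (ln (ln (max_modulus F r)) / ln r) < ereal c) at_top"
      using c(1) unfolding entire_order_def by (rule Limsup_lessD)
    moreover have "((\<lambda>r::real. r powr (c - 1)) \<longlongrightarrow> 0) at_top"
      using c(2) by (intro tendsto_neg_powr filterlim_ident) auto
    hence "eventually (\<lambda>r::real. r powr (c - 1) < \<epsilon>) at_top"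
      using eps by (rule order_tendstoD)
    ultimately show ?thesis
      using eventually_gt_at_top[of 1]
    proof eventually_elim
      case (elim r)
      show ?case
      proof (cases "max_modulus F r \<le> 1")
        case True
        also have "1 \<le> exp (\<epsilon> * r)"
          using elim eps by simp
        finally show ?thesis .
      next
        case False
        hence pos: "ln (max_modulus F r) > 0"
          by simp
        have "ln (ln (max_modulus F r)) < c * ln r"
          using elim by (simp add: field_simps)
        hence "exp (ln (ln (max_modulus F r))) < exp (c * ln r)"
          by simp
        hence "ln (max_modulus F r) < r powr c"
          using pos elim by (simp add: powr_def)
        also have "r powr c = r powr (c - 1) * r"
          using elim by (simp add: powr_diff)
        also have "\<dots> \<le> \<epsilon> * r"
          using elim by (intro mult_right_mono) auto
        finally have "exp (ln (max_modulus F r)) \<le> exp (\<epsilon> * r)"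
          by simp
        thus ?thesis
          using False by simp
      qed
    qed
  next
    assume "entire_order F = 1 \<and> entire_type 1 F = 0"
    hence "entire_type 1 F < ereal \<epsilon>"
      using eps by simp
    hence "eventually (\<lambda>r. ereal (ln (max_modulus F r) / r powr 1) < ereal \<epsilon>) at_top"
      unfolding entire_type_def by (rule Limsup_lessD)
    thus ?thesis
      using eventually_gt_at_top[of 0]
    proof eventually_elim
      case (elim r)
      show ?case
      proof (cases "max_modulus F r \<le> 1")
        case True
        also have "1 \<le> exp (\<epsilon> * r)"
          using elim eps by simp
        finally show ?thesis .
      next
        case False
        have "ln (max_modulus F r) < \<epsilon> * r"
          using elim by (simp add: field_simps)
        hence "exp (ln (max_modulus F r)) \<le> exp (\<epsilon> * r)"
          by simp
        thus ?thesis
          using False by simp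
      qed
    qed
  qed
  then obtain R where R: "\<And>r. r \<ge> R \<Longrightarrow> max_modulus F r \<le> exp (\<epsilon> * r)"
    unfolding eventually_at_top_linorder by blast
  have "norm (F z) \<le> 1 * exp (\<epsilon> * norm z)" if "norm z \<ge> R" for z
    using le_max[of z] R[OF that] by simp
  thus "\<exists>C R. \<forall>z. norm z \<ge> R \<longrightarrow> norm (F z) \<le> C * exp (\<epsilon> * norm z)"
    by blast
qed

text \<open>
  Write \<open>Q = exp G\<close> with \<open>G 0 = 0\<close>. The growth of \<open>Q\<close> bounds \<open>Re G\<close> from above by \<open>A = \<epsilon> * r + O(1)\<close> on the disc
  of radius \<open>r\<close>, so the Moebius image \<open>G / (2 * A - G)\<close> maps this disc to the unit disc and fixes 0. The
  Schwarz lemma then bounds \<open>\<bar>G\<bar>\<close>, as in the Borel-Caratheodory theorem, and \<open>G = 0\<close> results on letting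
  \<open>r\<close> tend to infinity and then \<open>\<epsilon>\<close> to 0.
\<close>
lemma zero_free_min_exp_type_eq_1:
  assumes hol: "Q holomorphic_on UNIV" and nz: "\<And>z. Q z \<noteq> 0"
    and Q0: "Q 0 = 1" and met: "min_exp_type Q"
  shows "Q z = 1"
proof -
  obtain g where g: "g holomorphic_on UNIV" "\<And>z. exp (g z) = Q z"
    using holomorphic_logarithm_exists[OF convex_UNIV open_UNIV hol nz, of 0] by auto
  define G where "G = (\<lambda>z. g z - g 0)"
  have holG: "G holomorphic_on A" for A
    unfolding G_def by (intro holomorphic_intros holomorphic_on_subset[OF g(1)]) auto
  have G0: "G 0 = 0"
    by (simp add: G_def)
  have expG: "exp (G z) = Q z" for z
    using g(2)[of 0] g(2)[of z] Q0 by (simp add: G_def exp_diff)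
  have main: "norm (G z) * (r - norm z) \<le> 2 * A * norm z"
    if A: "A > 0" "\<And>w. norm w < r \<Longrightarrow> Re (G w) < A" and r: "norm z < r" for A r
  proof -
    have rpos: "r > 0"
      using r by (meson norm_ge_zero order_le_less_trans)
    define \<phi> where "\<phi> = (\<lambda>w. G (of_real r * w) / (of_real (2 * A) - G (of_real r * w)))"
    have in_ball: "norm (of_real r * w :: complex) < r" if "norm w < 1" for w
      using that rpos by (simp add: norm_mult)
    have less: "norm (G w) < norm (of_real (2 * A) - G w)" if "norm w < r" for w
    proof -
      have "(Re (G w))\<^sup>2 + (Im (G w))\<^sup>2 < (2 * A - Re (G w))\<^sup>2 + (Im (G w))\<^sup>2"
        using A(1) A(2)[OF that] by (simp add: power2_eq_square algebra_simps)
      thus ?thesis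
        unfolding cmod_def by simp
    qed
    have ne: "of_real (2 * A) - G w \<noteq> 0" if "norm w < r" for w
      using less[OF that] by auto
    have "norm (\<phi> \<xi>) \<le> norm \<xi>" if "norm \<xi> < 1" for \<xi>
    proof (rule Schwarz_Lemma(1)[OF _ _ _ that])
      show "\<phi> holomorphic_on ball 0 1"
        unfolding \<phi>_def using ne in_ball
        by (intro holomorphic_intros holomorphic_on_compose_gen[OF _ holG, unfolded o_def, where t = UNIV])
           auto
      show "\<phi> 0 = 0"
        by (simp add: \<phi>_def G0)
      show "norm (\<phi> z) < 1" if "norm z < 1" for z
        using less[OF in_ball[OF that]] by (simp add: \<phi>_def norm_divide divide_less_eq)
    qed
    from this[of "z / of_real r"] have "norm (\<phi> (z / of_real r)) \<le> norm z / r"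
      using r rpos by (simp add: norm_divide)
    hence "norm (G z) / norm (of_real (2 * A) - G z) \<le> norm z / r"
      using rpos by (simp add: \<phi>_def norm_divide)
    moreover have "norm (of_real (2 * A) - G z) > 0"
      using ne[OF r] by simp
    ultimately have "norm (G z) * r \<le> norm z * norm (of_real (2 * A) - G z)"
      using rpos by (simp add: field_simps)
    also have "norm (of_real (2 * A) - G z) \<le> 2 * A + norm (G z)"
      using norm_triangle_ineq4[of "of_real (2 * A)" "G z"] A(1) by simp
    finally have "norm (G z) * r \<le> norm z * (2 * A + norm (G z))"
      by (simp add: mult_left_mono)
    thus ?thesis
      by (simp add: algebra_simps)
  qed
  have "norm (G z) = 0"
  proof (rule ccontr)
    assume "norm (G z) \<noteq> 0"
    hence gpos: "norm (G z) > 0"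
      by simp
    \<comment> \<open>Small enough that the term linear in \<open>r\<close> on the right stays below \<open>norm (G z) / 2 * r\<close>.\<close>
    define \<epsilon> where "\<epsilon> = norm (G z) / 4 / (norm z + 1)"
    have eps: "\<epsilon> > 0"
      unfolding \<epsilon>_def using gpos by (intro divide_pos_pos) (auto intro: add_nonneg_pos)
    have eps_le: "2 * \<epsilon> * norm z \<le> norm (G z) / 2"
    proof -
      have "2 * (g / 4 / q) * n = g / 2 * (n / q)" for g q n :: real
        by simp
      hence "2 * \<epsilon> * norm z = norm (G z) / 2 * (norm z / (norm z + 1))"
        by (simp only: \<epsilon>_def)
      also have "\<dots> \<le> norm (G z) / 2 * 1"
        by (intro mult_left_mono divide_le_eq_1_pos[THEN iffD2]) (auto intro: add_nonneg_pos)
      finally show ?thesis by simp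
    qed
    obtain C where C: "C \<ge> 1" "\<And>w. norm (Q w) \<le> C * exp (\<epsilon> * norm w)"
      using min_exp_typeD[OF met eps] by blast
    have ReG: "Re (G w) \<le> ln C + \<epsilon> * norm w" for w
    proof -
      have "Re (G w) = ln (norm (Q w))"
        by (simp flip: expG)
      also have "\<dots> \<le> ln (C * exp (\<epsilon> * norm w))"
        using C nz by (subst ln_le_cancel_iff) auto
      also have "\<dots> = ln C + \<epsilon> * norm w"
        using C(1) by (simp add: ln_mult)
      finally show ?thesis .
    qed
    define K where "K = 2 * (ln C + 1) * norm z + norm (G z) * norm z"
    have "norm (G z) / 2 * r \<le> K" if r: "norm z < r" for r
    proof -
      have rpos: "r > 0"
        using r by (meson norm_ge_zero order_le_less_trans)
      have "norm (G z) * (r - norm z) \<le> 2 * (ln C + \<epsilon> * r + 1) * norm z"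
      proof (rule main)
        show "ln C + \<epsilon> * r + 1 > 0"
          using C(1) eps rpos by (simp add: add_nonneg_pos)
        show "Re (G w) < ln C + \<epsilon> * r + 1" if "norm w < r" for w
          using ReG[of w] that eps mult_strict_left_mono[of "norm w" r \<epsilon>] by linarith
      qed (fact r)
      also have "\<dots> = 2 * (ln C + 1) * norm z + (2 * \<epsilon> * norm z) * r"
        by (simp add: algebra_simps)
      also have "\<dots> \<le> 2 * (ln C + 1) * norm z + norm (G z) / 2 * r"
        using eps_le rpos by (intro add_left_mono mult_right_mono) auto
      finally show ?thesis
        by (simp add: K_def algebra_simps)
    qed
    from this[of "max (norm z + 1) (2 * (K + 1) / norm (G z))"]
    have "norm (G z) / 2 * (2 * (K + 1) / norm (G z)) \<le> K"
      using gpos by (smt (verit) mult_left_mono max.cobounded2 max.strict_coboundedI1 divide_pos_pos)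
    thus False
      using gpos by simp
  qed
  thus ?thesis
    using expG[of z] by simp
qed

lemma entire_power_series:
  assumes "\<And>z. (\<lambda>k. c k * z ^ k) sums f (z :: complex)"
  shows "f holomorphic_on UNIV" and "(deriv ^^ k) f 0 = fact k * c k"
proof -
  have exp: "f has_fps_expansion Abs_fps c"
    by (rule has_fps_expansionI) (use assms in auto)
  show "(deriv ^^ k) f 0 = fact k * c k"
    using fps_nth_fps_expansion[OF exp, of k] by simp
  have "f = eval_fps (Abs_fps c)"
    using assms by (auto simp: eval_fps_def fun_eq_iff sums_iff)
  moreover have "fps_conv_radius (Abs_fps c) = \<infinity>"
    unfolding fps_conv_radius_def
    by (rule conv_radius_inftyI'') (use assms in \<open>auto simp: sums_iff\<close>)
  ultimately show "f holomorphic_on UNIV"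
    by (auto intro!: holomorphic_on_eval_fps)
qed

section \<open>Minimal exponential type and boundedness on a line\<close>

text \<open>
  Cauchy's inequality on the circle of radius \<open>k / \<delta>\<close> about \<open>z\<close>. This radius costs a factor \<open>exp k\<close> and
  gains \<open>fact k / k ^ k \<le> 1\<close>; choosing \<open>\<delta> = \<epsilon> / exp 1\<close> absorbs the former.
\<close>
lemma min_exp_type_higher_deriv:
  assumes hol: "h holomorphic_on UNIV" and met: "min_exp_type h" and eps: "\<epsilon> > 0"
  obtains C where "C \<ge> 1"
    "\<And>k z. norm ((deriv ^^ k) h z) \<le> C * \<epsilon> ^ k * exp (\<epsilon> * norm z)"
proof -
  define \<delta> where "\<delta> = \<epsilon> / exp 1"
  have delta: "\<delta> > 0" "\<delta> \<le> \<epsilon>" "exp 1 * \<delta> = \<epsilon>"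
    using eps by (simp_all add: \<delta>_def divide_le_eq)
  obtain C where C: "C \<ge> 1" "\<And>w. norm (h w) \<le> C * exp (\<delta> * norm w)"
    using min_exp_typeD[OF met delta(1)] by blast
  have "norm ((deriv ^^ k) h z) \<le> C * \<epsilon> ^ k * exp (\<epsilon> * norm z)" for k z
  proof (cases "k = 0")
    case True
    have "norm (h z) \<le> C * exp (\<epsilon> * norm z)"
      using C(1) delta by (intro order_trans[OF C(2)] mult_left_mono) (auto intro: mult_right_mono)
    thus ?thesis
      using True by simp
  next
    case False
    define r where "r = real k / \<delta>"
    have r: "r > 0" "\<delta> * r = real k"
      using False delta by (auto simp: r_def)
    have "norm ((deriv ^^ k) h z) \<le> fact k * (C * exp (\<delta> * (norm z + r))) / r ^ k"
    proof (rule Cauchy_inequality)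
      show "norm (h x) \<le> C * exp (\<delta> * (norm z + r))" if "norm (z - x) = r" for x
      proof -
        have "norm x \<le> norm z + r"
          using norm_triangle_ineq4[of z "z - x"] that by simp
        thus ?thesis
          using C(1) delta by (intro order_trans[OF C(2)] mult_left_mono) auto
      qed
    qed (use r hol in \<open>auto intro: holomorphic_on_subset holomorphic_on_imp_continuous_on\<close>)
    also have "\<dots> = C * exp (\<delta> * norm z) * (exp (real k) * (fact k / r ^ k))"
      using r(2) by (simp add: distrib_left exp_add)
    also have "fact k / r ^ k = \<delta> ^ k * (fact k / real k ^ k)"
      using False delta by (simp add: r_def power_divide)
    also have "exp (real k) * (\<delta> ^ k * (fact k / real k ^ k)) = \<epsilon> ^ k * (fact k / real k ^ k)"
      using exp_of_nat_mult[of k "1::real"] by (simp flip: delta(3) add: power_mult_distrib)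
    also have "C * exp (\<delta> * norm z) * (\<epsilon> ^ k * (fact k / real k ^ k))
        \<le> C * exp (\<epsilon> * norm z) * (\<epsilon> ^ k * 1)"
    proof (intro mult_mono mult_left_mono)
      have "fact k \<le> real k ^ k"
        using fact_le_power[of k, where ?'a = real] by simp
      thus "fact k / real k ^ k \<le> 1"
        using False by (simp add: divide_le_eq)
    qed (use C(1) eps delta in \<open>auto intro: mult_right_mono\<close>)
    finally show ?thesis
      by (simp add: mult_ac)
  qed
  thus ?thesis
    using that C(1) by blast
qed

text \<open>
  The series is the Laplace transform of \<open>h\<close> along the positive real axis (the Borel transform of \<open>h\<close>),
  which converges on the whole half plane \<open>Re s > 0\<close> because of the growth of \<open>h\<close>; the bound is the
  integral of \<open>M * exp (- Re s * x)\<close>. Instead of improper integrals the proof integrates by parts \<open>K\<close>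
  times over a finite interval: \<open>u\<close> below satisfies
  \<open>u' x = exp (- s * x) * (h x - (deriv ^^ K) h x / s ^ K)\<close>, and a function \<open>\<phi>\<close> with explicit derivative
  \<open>\<phi>' \<ge> \<bar>u'\<bar>\<close> controls its increments.
\<close>
lemma borel_transform_bound:
  assumes hol: "h holomorphic_on UNIV" and met: "min_exp_type h"
    and bound: "\<And>x. norm (h (of_real x)) \<le> M"
    and s: "Re s > 0"
    and lim: "(\<lambda>k. (deriv ^^ k) h 0 / s ^ Suc k) sums T"
  shows "norm T \<le> M / Re s"
proof -
  define \<sigma> where "\<sigma> = Re s"
  have sig: "\<sigma> > 0" "\<sigma> \<le> norm s"
    using s complex_Re_le_cmod[of s] by (auto simp: \<sigma>_def)
  have snz: "s \<noteq> 0" and M: "M \<ge> 0"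
    using s order_trans[OF norm_ge_zero bound[of 0]] by auto
  \<comment> \<open>With exponent \<open>\<sigma> / 2\<close> the factor \<open>exp (- \<sigma> * x)\<close> dominates the growth of \<open>h\<close> and its derivatives.\<close>
  obtain C where C: "C \<ge> 1"
    "\<And>k z. norm ((deriv ^^ k) h z) \<le> C * (\<sigma> / 2) ^ k * exp (\<sigma> / 2 * norm z)"
    using min_exp_type_higher_deriv[OF hol met, of "\<sigma> / 2"] sig by auto
  have half: "norm ((deriv ^^ k) h z / s ^ k) \<le> C * (1 / 2) ^ k * exp (\<sigma> / 2 * norm z)" for k z
  proof -
    have "norm ((deriv ^^ k) h z / s ^ k) \<le> C * (\<sigma> / 2) ^ k * exp (\<sigma> / 2 * norm z) / norm s ^ k"
      unfolding norm_divide norm_power by (intro divide_right_mono C) auto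
    also have "\<dots> = C * (\<sigma> / norm s) ^ k * (1 / 2) ^ k * exp (\<sigma> / 2 * norm z)"
      using snz by (simp add: power_divide field_simps)
    also have "\<dots> \<le> C * 1 * (1 / 2) ^ k * exp (\<sigma> / 2 * norm z)"
      using sig C(1) by (intro mult_right_mono mult_left_mono power_le_one) (auto simp: divide_le_eq)
    finally show ?thesis by simp
  qed
  define S where "S = (\<lambda>K z. \<Sum>k<K. (deriv ^^ k) h z / s ^ Suc k)"
  have derivs: "((deriv ^^ k) h has_field_derivative (deriv ^^ Suc k) h z) (at z)" for k z
    using holomorphic_derivI[OF holomorphic_higher_deriv[OF hol open_UNIV] open_UNIV] by simp
  have S_norm: "norm (S K z) \<le> 2 * C / norm s * exp (\<sigma> / 2 * norm z)" for K z
  proof -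
    have "norm (S K z) \<le> (\<Sum>k<K. C * (1 / 2) ^ k * exp (\<sigma> / 2 * norm z) / norm s)"
      unfolding S_def
    proof (rule sum_norm_le)
      fix k
      have "norm ((deriv ^^ k) h z / s ^ Suc k) = norm ((deriv ^^ k) h z / s ^ k) / norm s"
        by (simp add: norm_divide norm_mult)
      also have "\<dots> \<le> C * (1 / 2) ^ k * exp (\<sigma> / 2 * norm z) / norm s"
        by (intro divide_right_mono half) auto
      finally show "norm ((deriv ^^ k) h z / s ^ Suc k) \<le> C * (1 / 2) ^ k * exp (\<sigma> / 2 * norm z) / norm s" .
    qed
    also have "\<dots> = (\<Sum>k<K. (1 / 2) ^ k) * (C * exp (\<sigma> / 2 * norm z) / norm s)"
      unfolding sum_distrib_right by (intro sum.cong refl) simp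
    also have "\<dots> \<le> 2 * (C * exp (\<sigma> / 2 * norm z) / norm s)"
    proof (rule mult_right_mono)
      have "(\<Sum>k<K. (1 / 2) ^ k) = 2 - 2 * (1 / 2 :: real) ^ K"
        by (induction K) auto
      thus "(\<Sum>k<K. (1 / 2) ^ k) \<le> (2 :: real)"
        by simp
    qed (use C(1) in auto)
    finally show ?thesis
      by (simp add: mult_ac)
  qed
  have S_bound: "norm (S K 0) \<le> M / \<sigma> + 2 * C * (1 / 2) ^ K / \<sigma>
      + 2 * C / norm s * exp (- (\<sigma> / 2) * X)" if X: "X > 0" for K and X :: real
  proof -
    define u where "u = (\<lambda>x::real. - (exp (- s * of_real x) * S K (of_real x)))"
    define u' where "u' = (\<lambda>x::real. exp (- s * of_real x) *
      (h (of_real x) - (deriv ^^ K) h (of_real x) / s ^ K))"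
    define \<phi> where "\<phi> = (\<lambda>x::real. - (M / \<sigma>) * exp (- \<sigma> * x)
      - 2 * C * (1 / 2) ^ K / \<sigma> * exp (- (\<sigma> / 2) * x))"
    define \<phi>' where "\<phi>' = (\<lambda>x::real. M * exp (- \<sigma> * x)
      + C * (1 / 2) ^ K * exp (- (\<sigma> / 2) * x))"
    have S_deriv: "(S K has_field_derivative (\<Sum>k<K. (deriv ^^ Suc k) h z / s ^ Suc k)) (at z)" for z
      unfolding S_def by (intro DERIV_sum DERIV_cdivide derivs)
    have tele: "s * S K z - (\<Sum>k<K. (deriv ^^ Suc k) h z / s ^ Suc k)
        = h z - (deriv ^^ K) h z / s ^ K" for z
    proof -
      have "s * S K z - (\<Sum>k<K. (deriv ^^ Suc k) h z / s ^ Suc k)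
          = (\<Sum>k<K. (deriv ^^ k) h z / s ^ k - (deriv ^^ Suc k) h z / s ^ Suc k)"
        unfolding S_def sum_distrib_left sum_subtractf using snz by simp
      also have "\<dots> = h z - (deriv ^^ K) h z / s ^ K"
        by (subst sum_lessThan_telescope') simp
      finally show ?thesis .
    qed
    have u: "(u has_vector_derivative u' x) (at x)" for x
    proof -
      have "((\<lambda>z. - (exp (- s * z) * S K z)) has_field_derivative
          exp (- s * of_real x) * (s * S K (of_real x)
            - (\<Sum>k<K. (deriv ^^ Suc k) h (of_real x) / s ^ Suc k))) (at (of_real x))"
        by (rule derivative_eq_intros S_deriv refl)+ (simp add: algebra_simps)
      hence "((\<lambda>z. - (exp (- s * z) * S K z)) has_field_derivative u' x) (at (of_real x))"
        unfolding tele u'_def .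
      from has_vector_derivative_real_field[OF this] show ?thesis
        unfolding u_def .
    qed
    have phi: "(\<phi> has_vector_derivative \<phi>' x) (at x)" for x
      unfolding \<phi>_def \<phi>'_def has_real_derivative_iff_has_vector_derivative[symmetric]
      using sig by (auto intro!: derivative_eq_intros)
    have "norm (u X - u 0) \<le> \<phi> X - \<phi> 0"
    proof (rule differentiable_bound_general[where f' = u' and \<phi>' = \<phi>'])
      show "norm (u' x) \<le> \<phi>' x" if "0 < x" for x
      proof -
        have "norm (u' x) = exp (- \<sigma> * x) * norm (h (of_real x) - (deriv ^^ K) h (of_real x) / s ^ K)"
          by (simp add: u'_def norm_mult \<sigma>_def)
        also have "\<dots> \<le> exp (- \<sigma> * x) * (M + C * (1 / 2) ^ K * exp (\<sigma> / 2 * x))"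
          using norm_triangle_ineq4[of "h (of_real x)" "(deriv ^^ K) h (of_real x) / s ^ K"]
            bound[of x] half[of K "of_real x"] that
          by (intro mult_left_mono) (auto intro: order_trans)
        also have "\<dots> = M * exp (- \<sigma> * x) + C * (1 / 2) ^ K * (exp (- \<sigma> * x) * exp (\<sigma> / 2 * x))"
          by (simp add: algebra_simps)
        also have "\<dots> = \<phi>' x"
          unfolding \<phi>'_def exp_add[symmetric] by (simp add: algebra_simps)
        finally show ?thesis .
      qed
      show "continuous_on {0..X} u" "continuous_on {0..X} \<phi>"
        using u phi by (auto intro!: continuous_at_imp_continuous_on
            intro: has_vector_derivative_continuous)
    qed (use X u phi in auto)
    also have "\<phi> X - \<phi> 0 \<le> M / \<sigma> + 2 * C * (1 / 2) ^ K / \<sigma>"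
    proof -
      have "\<phi> X \<le> 0"
        unfolding \<phi>_def using M sig C(1)
        by (smt (verit) divide_nonneg_pos exp_ge_zero minus_mult_left mult_nonneg_nonneg zero_le_power half_gt_zero)
      thus ?thesis
        by (simp add: \<phi>_def)
    qed
    finally have "norm (u X - u 0) \<le> M / \<sigma> + 2 * C * (1 / 2) ^ K / \<sigma>" .
    moreover have "norm (u X) \<le> 2 * C / norm s * exp (- (\<sigma> / 2) * X)"
    proof -
      have "norm (u X) = exp (- \<sigma> * X) * norm (S K (of_real X))"
        by (simp add: u_def norm_mult \<sigma>_def)
      also have "\<dots> \<le> exp (- \<sigma> * X) * (2 * C / norm s * exp (\<sigma> / 2 * X))"
        using S_norm[of K "of_real X"] X by (intro mult_left_mono) auto
      also have "\<dots> = 2 * C / norm s * (exp (- \<sigma> * X) * exp (\<sigma> / 2 * X))"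
        by simp
      also have "\<dots> = 2 * C / norm s * exp (- (\<sigma> / 2) * X)"
        unfolding exp_add[symmetric] by (simp add: algebra_simps)
      finally show ?thesis .
    qed
    moreover have "norm (S K 0) \<le> norm (u X - u 0) + norm (u X)"
      using norm_triangle_ineq4[of "u X - u 0" "u X"] by (simp add: u_def)
    ultimately show ?thesis
      by linarith
  qed
  have exp_lim: "((\<lambda>X. exp (- (\<sigma> / 2) * X)) \<longlongrightarrow> 0) at_top"
    using sig by real_asymp
  have S_bound': "norm (S K 0) \<le> M / \<sigma> + 2 * C * (1 / 2) ^ K / \<sigma> + 2 * C / norm s * 0" for K
  proof (rule tendsto_lowerbound)
    show "((\<lambda>X. M / \<sigma> + 2 * C * (1 / 2) ^ K / \<sigma> + 2 * C / norm s * exp (- (\<sigma> / 2) * X))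
        \<longlongrightarrow> M / \<sigma> + 2 * C * (1 / 2) ^ K / \<sigma> + 2 * C / norm s * 0) at_top"
      by (intro tendsto_intros exp_lim)
    show "\<forall>\<^sub>F X in at_top. norm (S K 0)
        \<le> M / \<sigma> + 2 * C * (1 / 2) ^ K / \<sigma> + 2 * C / norm s * exp (- (\<sigma> / 2) * X)"
      using eventually_gt_at_top[of 0] by eventually_elim (rule S_bound)
  qed auto
  have "norm T \<le> M / \<sigma> + 2 * C * 0 / \<sigma> + 2 * C / norm s * 0"
  proof (rule tendsto_le)
    show "(\<lambda>K. norm (S K 0)) \<longlonglongrightarrow> norm T"
      using lim unfolding S_def sums_def by (intro tendsto_norm)
    show "(\<lambda>K. M / \<sigma> + 2 * C * (1 / 2) ^ K / \<sigma> + 2 * C / norm s * 0)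
        \<longlonglongrightarrow> M / \<sigma> + 2 * C * 0 / \<sigma> + 2 * C / norm s * 0"
      using sig by (intro tendsto_intros LIMSEQ_power_zero) auto
  qed (use S_bound' in auto)
  thus ?thesis
    by (simp add: \<sigma>_def)
qed

text \<open>
  A Liouville theorem of Phragmen-Lindelof type. Let \<open>E w = \<Sum>c\<^sub>k * w ^ k\<close> with \<open>c\<^sub>k\<close> the derivatives of \<open>h\<close> at 0, so
  that \<open>E (1 / s) / s\<close> is the Borel transform; \<open>E\<close> is entire because the \<open>c\<^sub>k\<close> decay faster than every
  geometric sequence. The half plane bound for \<open>h\<close> and for \<open>h (- z)\<close> gives \<open>\<bar>E w\<bar> * \<bar>Re w\<bar> \<le> M * \<bar>w\<bar>\<close>. This
  degenerates on the imaginary axis, but on \<open>\<bar>w\<bar> = R\<close> the polynomial \<open>w\<^sup>2 + R\<^sup>2 = 2 * w * Re w\<close> vanishes at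
  the two bad points to exactly the right order, so the maximum principle bounds
  \<open>(w\<^sup>2 + R\<^sup>2) * E w\<close> by \<open>2 * M * R\<^sup>2\<close>. Letting \<open>R\<close> tend to infinity shows that \<open>E\<close> is bounded by \<open>2 * M\<close>,
  hence constant, and all \<open>c\<^sub>k\<close> with \<open>k > 0\<close> are 0.
\<close>
lemma min_exp_type_bounded_on_reals_imp_constant:
  assumes hol: "h holomorphic_on UNIV" and met: "min_exp_type h"
    and bound: "\<And>x. norm (h (of_real x)) \<le> M"
  shows "h z = h 0"
proof -
  define c where "c = (\<lambda>k. (deriv ^^ k) h 0)"
  define E where "E = (\<lambda>w. \<Sum>k. c k * w ^ k)"
  have M: "M \<ge> 0"
    using order_trans[OF norm_ge_zero bound[of 0]] by simp
  have E_sums: "(\<lambda>k. c k * w ^ k) sums E w" for w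
  proof -
    define \<epsilon> where "\<epsilon> = 1 / (2 * (norm w + 1))"
    have eps: "\<epsilon> > 0" "\<epsilon> * norm w \<le> 1 / 2"
      using norm_ge_zero[of w] unfolding \<epsilon>_def by (auto simp: divide_le_eq simp del: norm_ge_zero)
    obtain C where C: "C \<ge> 1" "\<And>k z. norm ((deriv ^^ k) h z) \<le> C * \<epsilon> ^ k * exp (\<epsilon> * norm z)"
      using min_exp_type_higher_deriv[OF hol met eps(1)] by blast
    have le: "norm (c k * w ^ k) \<le> C * (1 / 2) ^ k" for k
    proof -
      have "norm (c k * w ^ k) \<le> (C * \<epsilon> ^ k) * norm w ^ k"
        using C(2)[of k 0] by (auto simp: c_def norm_mult norm_power intro!: mult_right_mono)
      also have "\<dots> = C * (\<epsilon> * norm w) ^ k"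
        by (simp add: power_mult_distrib)
      also have "\<dots> \<le> C * (1 / 2) ^ k"
        using eps C(1) by (intro mult_left_mono power_mono) auto
      finally show ?thesis .
    qed
    have "summable (\<lambda>k. C * (1 / 2) ^ k)"
      by (intro summable_mult summable_geometric) auto
    hence "summable (\<lambda>k. c k * w ^ k)"
      by (rule summable_comparison_test'[where N = 0]) (rule le)
    thus ?thesis
      unfolding E_def by (rule summable_sums)
  qed
  note E = entire_power_series[of c E, OF E_sums]
  have half_plane: "norm (E w) * \<bar>Re w\<bar> \<le> M * norm w" for w
  proof -
    have Re_inv: "Re (1 / w) = Re w / (norm w)\<^sup>2"
      using Re_divide[of 1 w] unfolding cmod_power2 by simp
    have *: "norm T \<le> M / \<bar>Re (1 / w)\<bar> \<Longrightarrow> T = c * E w \<Longrightarrow> norm c = norm w \<Longrightarrow>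
        Re w \<noteq> 0 \<Longrightarrow> norm (E w) * \<bar>Re w\<bar> \<le> M * norm w" for T c
    proof -
      assume T: "norm T \<le> M / \<bar>Re (1 / w)\<bar>" "T = c * E w" "norm c = norm w" and w: "Re w \<noteq> 0"
      have wpos: "norm w > 0" "\<bar>Re w\<bar> > 0"
        using w by auto
      have "norm w * norm (E w) \<le> M / (\<bar>Re w\<bar> / (norm w)\<^sup>2)"
        using T(1) unfolding T(2) norm_mult T(3) Re_inv by (simp only: abs_divide) simp
      hence "norm w * norm (E w) * \<bar>Re w\<bar> \<le> M * (norm w)\<^sup>2"
        using wpos by (simp add: pos_le_divide_eq)
      hence "norm w * (norm (E w) * \<bar>Re w\<bar>) \<le> norm w * (M * norm w)"
        by (simp add: power2_eq_square mult_ac)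
      thus ?thesis
        using wpos(1) by (simp only: mult_le_cancel_left_pos)
    qed
    consider "Re w = 0" | "Re w > 0" | "Re w < 0"
      by linarith
    thus ?thesis
    proof cases
      case 1
      thus ?thesis using M by simp
    next
      case 2
      hence pos: "Re (1 / w) > 0"
        unfolding Re_inv by (auto intro!: divide_pos_pos)
      have "(\<lambda>k. w * (c k * w ^ k)) sums (w * E w)"
        by (intro sums_mult E_sums)
      hence "(\<lambda>k. (deriv ^^ k) h 0 / (1 / w) ^ Suc k) sums (w * E w)"
        by (simp add: c_def mult_ac power_divide)
      from borel_transform_bound[OF hol met bound pos this] pos
      have "norm (w * E w) \<le> M / \<bar>Re (1 / w)\<bar>"
        by simp
      thus ?thesis
        by (rule *) (use 2 in auto)
    next
      case 3
      define h' where "h' = (\<lambda>z. h (- 1 * z))"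
      have hol': "h' holomorphic_on UNIV"
        unfolding h'_def
        by (intro holomorphic_on_compose_gen[OF _ hol, unfolded o_def] holomorphic_intros) auto
      have met': "min_exp_type h'"
        using met unfolding min_exp_type_def h'_def by (metis mult_minus1 norm_minus_cancel)
      have bound': "norm (h' (of_real x)) \<le> M" for x
        using bound[of "- x"] by (simp add: h'_def)
      have deriv': "(deriv ^^ k) h' 0 = (- 1) ^ k * c k" for k
        unfolding h'_def c_def
        using higher_deriv_compose_linear[OF hol open_UNIV open_UNIV, of 0 "-1" k] by simp
      have "Re (1 / w) < 0"
        unfolding Re_inv using 3 by (intro divide_neg_pos) auto
      hence pos: "Re (1 / (- w)) > 0"
        by simp
      have "(\<lambda>k. - w * (c k * w ^ k)) sums (- w * E w)"
        by (intro sums_mult E_sums)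
      moreover have "(deriv ^^ k) h' 0 / (1 / (- w)) ^ Suc k = - w * (c k * w ^ k)" for k
      proof -
        have inv: "X / (1 / v) ^ n = X * v ^ n" for X v :: complex and n
          by (simp add: power_divide)
        have "(deriv ^^ k) h' 0 / (1 / (- w)) ^ Suc k = (- 1) ^ k * c k * (- w) ^ Suc k"
          unfolding deriv' inv ..
        also have "\<dots> = - w * (c k * ((- 1) ^ k * (- w) ^ k))"
          by simp
        also have "(- 1) ^ k * (- w) ^ k = w ^ k"
          unfolding power_mult_distrib[symmetric] by simp
        finally show ?thesis .
      qed
      ultimately have "(\<lambda>k. (deriv ^^ k) h' 0 / (1 / (- w)) ^ Suc k) sums (- w * E w)"
        by simp
      from borel_transform_bound[OF hol' met' bound' pos this]
      have "norm (- w * E w) \<le> M / \<bar>Re (1 / w)\<bar>"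
        using pos by simp
      thus ?thesis
        by (rule *[where c = "- w"]) (use 3 in auto)
    qed
  qed
  have E_bound: "norm (E w) \<le> 2 * M" for w
  proof -
    have le: "norm (w\<^sup>2 + of_real (R\<^sup>2)) * norm (E w) \<le> 2 * M * R\<^sup>2" if R: "R > norm w" for R
    proof -
      have Rpos: "R > 0"
        using R by (meson norm_ge_zero order_le_less_trans)
      have "norm ((w\<^sup>2 + of_real (R\<^sup>2)) * E w) \<le> 2 * M * R\<^sup>2"
      proof (rule maximum_modulus_frontier[where S = "cball 0 R" and f = "\<lambda>v. (v\<^sup>2 + of_real (R\<^sup>2)) * E v"])
        show "(\<lambda>v. (v\<^sup>2 + of_real (R\<^sup>2)) * E v) holomorphic_on interior (cball 0 R)"
          by (intro holomorphic_intros holomorphic_on_subset[OF E(1)]) auto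
        show "continuous_on (closure (cball 0 R)) (\<lambda>v. (v\<^sup>2 + of_real (R\<^sup>2)) * E v)"
          by (intro holomorphic_on_imp_continuous_on holomorphic_intros holomorphic_on_subset[OF E(1)]) auto
        fix v assume "v \<in> frontier (cball (0::complex) R)"
        hence v: "norm v = R"
          using Rpos by (simp add: frontier_cball)
        have "of_real (R\<^sup>2) = v * cnj v"
          using complex_norm_square[of v] v by simp
        hence "v\<^sup>2 + of_real (R\<^sup>2) = v * of_real (2 * Re v)"
          by (simp add: power2_eq_square complex_add_cnj flip: distrib_left)
        hence "norm ((v\<^sup>2 + of_real (R\<^sup>2)) * E v) = 2 * R * (norm (E v) * \<bar>Re v\<bar>)"
          by (simp only: norm_mult norm_of_real v abs_mult) simp
        also have "\<dots> \<le> 2 * R * (M * norm v)"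
          using Rpos by (intro mult_left_mono half_plane) auto
        finally show "norm ((v\<^sup>2 + of_real (R\<^sup>2)) * E v) \<le> 2 * M * R\<^sup>2"
          by (simp add: v power2_eq_square mult_ac)
      qed (use R in auto)
      thus ?thesis
        by (simp only: norm_mult)
    qed
    show ?thesis
    proof (rule tendsto_le)
      have lim0: "((\<lambda>R::real. of_real (1 / R)) \<longlongrightarrow> (of_real 0 :: complex)) at_top"
        by (intro tendsto_of_real) real_asymp
      have "((\<lambda>R::real. norm ((w * of_real (1 / R))\<^sup>2 + 1) * norm (E w))
          \<longlongrightarrow> norm ((w * of_real 0)\<^sup>2 + 1) * norm (E w)) at_top"
        by (intro tendsto_mult tendsto_norm tendsto_add tendsto_power tendsto_const lim0)
      thus "((\<lambda>R::real. norm ((w * of_real (1 / R))\<^sup>2 + 1) * norm (E w)) \<longlongrightarrow> norm (E w)) at_top"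
        by simp
      show "\<forall>\<^sub>F R in at_top. norm ((w * of_real (1 / R))\<^sup>2 + 1) * norm (E w) \<le> 2 * M"
        using eventually_gt_at_top[of "norm w"] eventually_gt_at_top[of 0]
      proof eventually_elim
        case (elim R)
        have "(w * of_real (1 / R))\<^sup>2 + 1 = (w\<^sup>2 + of_real (R\<^sup>2)) / of_real (R\<^sup>2)"
          using elim by (simp add: field_simps)
        hence "norm ((w * of_real (1 / R))\<^sup>2 + 1) = norm (w\<^sup>2 + of_real (R\<^sup>2)) / R\<^sup>2"
          using elim by (simp only: norm_divide norm_of_real) simp
        hence "norm ((w * of_real (1 / R))\<^sup>2 + 1) * norm (E w)
            = norm (w\<^sup>2 + of_real (R\<^sup>2)) * norm (E w) / R\<^sup>2"
          by simp
        also have "\<dots> \<le> 2 * M * R\<^sup>2 / R\<^sup>2"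
          using le[of R] elim by (intro divide_right_mono) auto
        finally show ?case
          using elim by simp
      qed
    qed (auto intro: tendsto_const)
  qed
  have "bounded (range E)"
    unfolding bounded_iff using E_bound by blast
  then obtain b where "\<And>w. E w = b"
    using Liouville_theorem[OF E(1)] by (auto simp: constant_on_def)
  hence "E = (\<lambda>_. b)" by blast
  hence "(deriv ^^ n) h 0 = 0" if "n > 0" for n
    using E(2)[of n] that by (simp add: c_def)
  thus ?thesis
    using holomorphic_fun_eq_const_on_connected[OF hol open_UNIV connected_UNIV, of 0 z] by simp
qed

section \<open>Canonical products of genus zero\<close>

lemma norm_one_minus_ge_exp:
  assumes "norm (w :: complex) \<le> 1 / 2"
  shows "norm (1 - w) \<ge> exp (- 2 * norm w)"
proof -
  have "- 2 * norm w \<le> - norm w - 2 * (norm w)\<^sup>2"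
    using mult_left_mono[OF assms, of "norm w"] by (simp add: power2_eq_square)
  also have "\<dots> \<le> ln (1 - norm w)"
    using assms by (intro ln_one_minus_pos_lower_bound) auto
  finally have "exp (- 2 * norm w) \<le> exp (ln (1 - norm w))"
    by simp
  also have "\<dots> = 1 - norm w"
    using assms by (intro exp_ln) linarith
  also have "\<dots> \<le> norm (1 - w)"
    using norm_triangle_ineq2[of 1 w] by simp
  finally show ?thesis .
qed

text \<open>
  The case of vanishing exponents in the Weierstrass product: summability of \<open>1 / \<bar>a n\<bar>\<close> makes the
  bare product \<open>\<Prod>(1 - z / a n)\<close> converge.
\<close>
locale genus_zero_zeros =
  fixes a :: "nat \<Rightarrow> complex"
  assumes nonzero: "\<And>n. a n \<noteq> 0"
    and summable_inverse: "summable (\<lambda>n. inverse (norm (a n)))"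
begin

lemma a_at_infinity: "filterlim a at_infinity at_top"
proof -
  have "(\<lambda>n. norm (inverse (a n))) \<longlonglongrightarrow> 0"
    using summable_LIMSEQ_zero[OF summable_inverse] by (simp add: norm_inverse)
  hence "(\<lambda>n. inverse (a n)) \<longlonglongrightarrow> 0"
    by (rule tendsto_norm_zero_cancel)
  hence "filterlim (\<lambda>n. inverse (a n)) (at 0) at_top"
    using nonzero by (auto simp: filterlim_at)
  thus ?thesis
    by (simp only: filterlim_inverse_at_iff)
qed

sublocale W: weierstrass_product a "\<lambda>_. 0"
proof
  show "summable (\<lambda>n. (r / norm (a n)) ^ Suc 0)" for r
    using summable_mult[OF summable_inverse, of r] by (simp add: divide_inverse)
qed (use nonzero a_at_infinity in auto)

abbreviation P :: "complex \<Rightarrow> complex" where "P \<equiv> W.f"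

lemma P_limit: "(\<lambda>n. \<Prod>k<n. 1 - z / a k) \<longlonglongrightarrow> P z"
  using has_prod_imp_tendsto'[OF W.has_prod[of z]] by (simp add: weierstrass_factor_def)

lemma finite_small_zeros: "finite {n. norm (a n) \<le> R}"
proof -
  have "eventually (\<lambda>n. norm (a n) > R) at_top"
    using a_at_infinity unfolding filterlim_at_infinity_conv_norm_at_top filterlim_at_top_dense by blast
  then obtain N where N: "\<And>n. n \<ge> N \<Longrightarrow> norm (a n) > R"
    unfolding eventually_at_top_linorder by blast
  have "{n. norm (a n) \<le> R} \<subseteq> {..<N}"
    using N by (force simp: not_less[symmetric])
  thus ?thesis
    by (rule finite_subset) auto
qed

text \<open>
  Dividing by the canonical product is cheap if small and large zeros are treated differently. With
  \<open>R = 2 * \<bar>z\<bar>\<close> let \<open>P1\<close> collect the finitely many factors with \<open>\<bar>a n\<bar> \<le> R\<close> and \<open>P2\<close> the others. On the circle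
  \<open>\<bar>w\<bar> = 2 * R\<close> every factor of \<open>P1\<close> has modulus at least 1, so \<open>\<bar>H * P2\<bar> \<le> \<bar>H * P\<bar> \<le> B\<close> there, and by the maximum
  principle also at \<open>z\<close>. At \<open>z\<close> itself, \<open>\<bar>z / a n\<bar> \<le> 1 / 2\<close> in each factor of \<open>P2\<close>, so that
  \<open>\<bar>P2 z\<bar> \<ge> exp (- 2 * \<bar>z\<bar> * \<Sum>1 / \<bar>a n\<bar>)\<close> with the sum over the large zeros; it is below \<open>\<delta>\<close> once \<open>\<bar>z\<bar>\<close> is
  large.
\<close>
lemma quotient_bound:
  assumes hol: "H holomorphic_on UNIV" and "\<delta> > 0"
  obtains R0 where "R0 > 0"
    "\<And>z B. norm z \<ge> R0 \<Longrightarrow> (\<And>w. norm w = 4 * norm z \<Longrightarrow> norm (H w * P w) \<le> B) \<Longrightarrow>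
       norm (H z) \<le> B * exp (2 * \<delta> * norm z)"
proof -
  obtain N where N: "(\<Sum>n. inverse (norm (a (n + N)))) < \<delta>"
    using suminf_exist_split[OF \<open>\<delta> > 0\<close> summable_inverse] by (auto dest: abs_less_iff[THEN iffD1])
  have sumN: "summable (\<lambda>n. inverse (norm (a (n + N))))"
    using summable_inverse by (rule summable_ignore_initial_segment)
  \<comment> \<open>Any bound for the first \<open>N\<close> zeros: beyond it they all count as small.\<close>
  define R0 where "R0 = 1 + (\<Sum>n<N. norm (a n))"
  have R0: "R0 > 0" "\<And>n. n < N \<Longrightarrow> norm (a n) \<le> R0"
  proof -
    show "R0 > 0"
      unfolding R0_def by (intro add_pos_nonneg sum_nonneg) auto
    show "norm (a n) \<le> R0" if "n < N" for n
      unfolding R0_def using member_le_sum[of n "{..<N}" "\<lambda>n. norm (a n)"] that by simp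
  qed
  have "norm (H z) \<le> B * exp (2 * \<delta> * norm z)"
    if z: "norm z \<ge> R0" and B: "\<And>w. norm w = 4 * norm z \<Longrightarrow> norm (H w * P w) \<le> B" for z B
  proof -
    define R where "R = 2 * norm z"
    define S where "S = {n. norm (a n) \<le> R}"
    have fin: "finite S"
      unfolding S_def by (rule finite_small_zeros)
    then obtain K where K: "S \<subseteq> {..<K}"
      by (meson finite_nat_iff_bounded)
    have Rpos: "R > 0" "norm z > 0"
      using z R0 unfolding R_def by linarith+
    have N_S: "{..<N} \<subseteq> S"
      using R0(2) z R0(1) unfolding S_def R_def by fastforce
    \<comment> \<open>\<open>P2\<close> is a finite product times a shifted canonical product; this is what makes it entire.\<close>
    interpret T: genus_zero_zeros "\<lambda>n. a (n + K)"
      by standard (use nonzero summable_inverse in \<open>auto intro: summable_ignore_initial_segment\<close>)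
    define P1 where "P1 = (\<lambda>w. \<Prod>n\<in>S. 1 - w / a n)"
    define P2 where "P2 = (\<lambda>w. (\<Prod>n\<in>{..<K} - S. 1 - w / a n) * T.W.f w)"
    have P2_lim: "(\<lambda>m. \<Prod>n\<in>{..<m} - S. 1 - w / a n) \<longlonglongrightarrow> P2 w" for w
    proof (rule LIMSEQ_offset[where k = K])
      have "(\<Prod>n\<in>{..<m + K} - S. 1 - w / a n)
          = (\<Prod>n\<in>{..<K} - S. 1 - w / a n) * (\<Prod>n<m. 1 - w / a (n + K))" for m
      proof -
        have "{..<m + K} - S = ({..<K} - S) \<union> {K..<m + K}" "({..<K} - S) \<inter> {K..<m + K} = {}"
          using K by auto
        moreover have "(\<Prod>n\<in>{K..<m + K}. 1 - w / a n) = (\<Prod>n<m. 1 - w / a (n + K))"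
          by (rule prod.reindex_bij_witness[of _ "\<lambda>n. n + K" "\<lambda>n. n - K"]) auto
        ultimately show ?thesis
          by (simp add: prod.union_disjoint)
      qed
      thus "(\<lambda>m. \<Prod>n\<in>{..<m + K} - S. 1 - w / a n) \<longlonglongrightarrow> P2 w"
        unfolding P2_def using T.P_limit[of w] by (auto intro!: tendsto_intros)
    qed
    have P_eq: "P w = P1 w * P2 w" for w
    proof (rule LIMSEQ_unique)
      have "(\<lambda>m. P1 w * (\<Prod>n\<in>{..<m} - S. 1 - w / a n)) \<longlonglongrightarrow> P1 w * P2 w"
        by (intro tendsto_intros P2_lim)
      moreover have "eventually (\<lambda>m. P1 w * (\<Prod>n\<in>{..<m} - S. 1 - w / a n) = (\<Prod>n<m. 1 - w / a n)) at_top"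
        using eventually_ge_at_top[of K]
      proof eventually_elim
        case (elim m)
        hence "S \<subseteq> {..<m}"
          using K by auto
        thus ?case
          unfolding P1_def using prod.subset_diff[of S "{..<m}" "\<lambda>n. 1 - w / a n"] by (simp add: mult.commute)
      qed
      ultimately show "(\<lambda>m. \<Prod>n<m. 1 - w / a n) \<longlonglongrightarrow> P1 w * P2 w"
        by (rule Lim_transform_eventually)
    qed (rule P_limit)
    have holP2: "P2 holomorphic_on A" for A
      unfolding P2_def by (intro holomorphic_intros T.W.holomorphic) (use nonzero in auto)
    have P1_ge: "norm (P1 w) \<ge> 1" if "norm w = 2 * R" for w
    proof -
      have "1 \<le> norm (1 - w / a n)" if "n \<in> S" for n
      proof -
        have "2 * norm (a n) \<le> norm w"
          using that \<open>norm w = 2 * R\<close> by (simp add: S_def)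
        hence "2 \<le> norm (w / a n)"
          using nonzero[of n] by (simp add: norm_divide pos_le_divide_eq)
        thus ?thesis
          using norm_triangle_ineq2[of "w / a n" 1] by (simp add: norm_minus_commute)
      qed
      thus ?thesis
        unfolding P1_def prod_norm[symmetric] by (intro prod_ge_1) auto
    qed
    have P2_ge: "norm (P2 z) \<ge> exp (- (2 * \<delta> * norm z))"
    proof (rule tendsto_lowerbound)
      show "(\<lambda>m. norm (\<Prod>n\<in>{..<m} - S. 1 - z / a n)) \<longlonglongrightarrow> norm (P2 z)"
        by (intro tendsto_norm P2_lim)
      have "exp (- (2 * \<delta> * norm z)) \<le> norm (\<Prod>n\<in>{..<m} - S. 1 - z / a n)" for m
      proof -
        have "(\<Sum>n\<in>{..<m} - S. inverse (norm (a n))) \<le> (\<Sum>n\<in>{N..<N + m}. inverse (norm (a n)))"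
        proof (rule sum_mono2)
          have "N \<le> n" if "n \<notin> S" for n
            using N_S that by (metis lessThan_iff linorder_not_le subsetD)
          thus "{..<m} - S \<subseteq> {N..<N + m}"
            by auto
        qed auto
        also have "\<dots> = (\<Sum>n<m. inverse (norm (a (n + N))))"
          by (rule sum.reindex_bij_witness[of _ "\<lambda>n. n + N" "\<lambda>n. n - N"]) auto
        also have "\<dots> \<le> (\<Sum>n. inverse (norm (a (n + N))))"
          by (intro sum_le_suminf sumN) auto
        also have "\<dots> \<le> \<delta>"
          using N by simp
        finally have "2 * norm z * (\<Sum>n\<in>{..<m} - S. inverse (norm (a n))) \<le> 2 * norm z * \<delta>"
          by (intro mult_left_mono) auto
        hence "exp (- (2 * \<delta> * norm z)) \<le> exp (\<Sum>n\<in>{..<m} - S. - 2 * norm (z / a n))"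
          by (simp add: sum_distrib_left norm_mult norm_inverse divide_inverse sum_negf mult_ac)
        also have "\<dots> = (\<Prod>n\<in>{..<m} - S. exp (- 2 * norm (z / a n)))"
          by (rule exp_sum) auto
        also have "\<dots> \<le> (\<Prod>n\<in>{..<m} - S. norm (1 - z / a n))"
        proof (intro prod_mono conjI norm_one_minus_ge_exp)
          fix n assume "n \<in> {..<m} - S"
          hence "2 * norm z < norm (a n)"
            by (simp add: S_def R_def)
          thus "norm (z / a n) \<le> 1 / 2"
            using nonzero[of n] by (simp add: norm_divide divide_le_eq)
        qed auto
        finally show ?thesis
          by (simp add: prod_norm)
      qed
      thus "\<forall>\<^sub>F m in sequentially. exp (- (2 * \<delta> * norm z)) \<le> norm (\<Prod>n\<in>{..<m} - S. 1 - z / a n)"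
        by simp
    qed auto
    have "norm (H z * P2 z) \<le> B"
    proof (rule maximum_modulus_frontier[where S = "cball 0 (2 * R)" and f = "\<lambda>w. H w * P2 w"])
      show "(\<lambda>w. H w * P2 w) holomorphic_on interior (cball 0 (2 * R))"
        by (intro holomorphic_intros holP2 holomorphic_on_subset[OF hol]) auto
      show "continuous_on (closure (cball 0 (2 * R))) (\<lambda>w. H w * P2 w)"
        by (intro holomorphic_on_imp_continuous_on holomorphic_intros holP2 holomorphic_on_subset[OF hol]) auto
      fix w assume "w \<in> frontier (cball (0::complex) (2 * R))"
      hence w: "norm w = 2 * R"
        using Rpos by (simp add: frontier_cball)
      have "norm (H w * P2 w) * 1 \<le> norm (H w * P2 w) * norm (P1 w)"
        using P1_ge[OF w] by (intro mult_left_mono) auto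
      also have "\<dots> = norm (H w * P w)"
        by (simp add: P_eq norm_mult)
      also have "\<dots> \<le> B"
        using w by (intro B) (simp add: R_def)
      finally show "norm (H w * P2 w) \<le> B"
        by simp
    qed (use Rpos in \<open>auto simp: R_def\<close>)
    have "norm (H z) * exp (- (2 * \<delta> * norm z)) \<le> norm (H z) * norm (P2 z)"
      using P2_ge by (intro mult_left_mono) auto
    also have "\<dots> \<le> B"
      using \<open>norm (H z * P2 z) \<le> B\<close> by (simp add: norm_mult)
    finally have "norm (H z) * exp (- (2 * \<delta> * norm z)) * exp (2 * \<delta> * norm z) \<le> B * exp (2 * \<delta> * norm z)"
      by (intro mult_right_mono) auto
    thus ?thesis
      by (simp add: mult.assoc flip: exp_add)
  qed
  thus ?thesis
    using that R0(1) by blast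
qed

text \<open>
  The circle of radius \<open>4 * \<bar>z\<bar>\<close> contributes \<open>4 * \<epsilon> / 6\<close> to the exponent and the lower bound for the large
  zeros another \<open>2 * \<epsilon> / 6\<close>, whence the choice of \<open>\<epsilon> / 6\<close>.
\<close>
lemma min_exp_type_quotient:
  assumes hol: "H holomorphic_on UNIV" and met: "min_exp_type (\<lambda>z. H z * P z)"
  shows "min_exp_type H"
proof (rule min_exp_typeI_outside)
  show "continuous_on UNIV H"
    using hol by (rule holomorphic_on_imp_continuous_on)
  fix \<epsilon> :: real assume "\<epsilon> > 0"
  then obtain C where C: "C \<ge> 1" "\<And>w. norm (H w * P w) \<le> C * exp (\<epsilon> / 6 * norm w)"
    using min_exp_typeD[OF met, of "\<epsilon> / 6"] by auto
  obtain R0 where R0: "R0 > 0"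
    "\<And>z B. norm z \<ge> R0 \<Longrightarrow> (\<And>w. norm w = 4 * norm z \<Longrightarrow> norm (H w * P w) \<le> B) \<Longrightarrow>
       norm (H z) \<le> B * exp (2 * (\<epsilon> / 6) * norm z)"
    using quotient_bound[OF hol, of "\<epsilon> / 6"] \<open>\<epsilon> > 0\<close> by auto
  have "norm (H z) \<le> C * exp (\<epsilon> * norm z)" if "norm z \<ge> R0" for z
  proof -
    have "norm (H z) \<le> C * exp (\<epsilon> / 6 * (4 * norm z)) * exp (2 * (\<epsilon> / 6) * norm z)"
      using C(2) by (intro R0(2) that) metis
    also have "\<dots> = C * exp (\<epsilon> * norm z)"
      by (simp add: mult.assoc field_simps flip: exp_add)
    finally show ?thesis .
  qed
  thus "\<exists>C R. \<forall>z. norm z \<ge> R \<longrightarrow> norm (H z) \<le> C * exp (\<epsilon> * norm z)"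
    by blast
qed

lemma P_0: "P 0 = 1"
  using P_limit[of 0] by (simp add: LIMSEQ_const_iff)

text \<open>
  Zeros and multiplicities agree, so \<open>F = Q * P\<close> with \<open>Q\<close> zero-free; the quotient \<open>Q\<close> inherits minimal
  exponential type and is therefore 1. Minimal type is what excludes the factor \<open>exp (c * z)\<close> that
  Hadamard's theorem would allow at order one.
\<close>
lemma hadamard_genus_zero:
  assumes hol: "F holomorphic_on UNIV" and F0: "F 0 = 1" and met: "min_exp_type F"
    and zeros: "enumerates_zeros F a"
  shows "F = P"
proof -
  have zorder_eq: "zorder P z = zorder F z" for z
    using zeros by (simp add: W.zorder enumerates_zeros_def vimage_def)
  have freq: "frequently (\<lambda>w. G w \<noteq> 0) (at z)" if "G holomorphic_on UNIV" "G 0 = 1" for G :: "complex \<Rightarrow> complex" and z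
    using non_zero_neighbour_alt[OF that(1) open_UNIV connected_UNIV, of z 0] that(2)
    by (auto intro: eventually_frequently elim: eventually_mono)
  have zero_iff: "G z = 0 \<longleftrightarrow> zorder G z > 0" if "G holomorphic_on UNIV" "G 0 = 1" for G z
    using zorder_pos_iff[OF that(1) open_UNIV _ freq[OF that]] by simp
  have same_zeros: "P z = 0 \<longleftrightarrow> F z = 0" for z
    unfolding zero_iff[OF hol F0] zero_iff[OF W.holomorphic P_0] zorder_eq ..
  obtain Q where Q: "Q holomorphic_on UNIV" "\<And>z. Q z \<noteq> 0" "\<And>z. F z = Q z * P z"
  proof (rule holomorphic_zorder_factorization[OF hol open_UNIV connected_UNIV W.holomorphic same_zeros zorder_eq])
    fix Q assume "Q holomorphic_on UNIV" "\<And>z. z \<in> UNIV \<Longrightarrow> Q z \<noteq> 0"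
      "\<And>z. z \<in> UNIV \<Longrightarrow> F z = Q z * P z"
    thus thesis
      by (intro that[of Q]) auto
  qed
  have QP: "(\<lambda>z. Q z * P z) = F"
    by (rule ext) (rule Q(3)[symmetric])
  have "min_exp_type Q"
    by (rule min_exp_type_quotient[OF Q(1)]) (unfold QP, rule met)
  have "Q 0 = 1"
    using Q(3)[of 0] F0 P_0 by simp
  hence "Q z = 1" for z
    using zero_free_min_exp_type_eq_1[OF Q(1,2) _ \<open>min_exp_type Q\<close>] by blast
  thus ?thesis
    unfolding QP[symmetric] by simp
qed

end

section \<open>Weighted means along segments\<close>

lemma integrable_continuous_mult:
  fixes g \<phi> :: "real \<Rightarrow> complex"
  assumes g: "continuous_on {0..1} g" and \<phi>: "integrable (lebesgue_on {0..1}) \<phi>"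
  shows "integrable (lebesgue_on {0..1}) (\<lambda>t. g t * \<phi> t)"
proof -
  have "compact (g ` {0..1})"
    by (intro compact_continuous_image g) auto
  then obtain B where "\<forall>w\<in>g ` {0..1}. norm w \<le> B"
    using compact_imp_bounded bounded_iff by metis
  hence B: "norm (g t) \<le> B" if "t \<in> {0..1}" for t
    using that by blast
  show ?thesis
  proof (rule Bochner_Integration.integrable_bound)
    show "integrable (lebesgue_on {0..1}) (\<lambda>t. B * norm (\<phi> t))"
      by (intro integrable_mult_right integrable_norm \<phi>)
    show "(\<lambda>t. g t * \<phi> t) \<in> borel_measurable (lebesgue_on {0..1})"
      by (intro borel_measurable_times continuous_imp_measurable_on_sets_lebesgue g
          borel_measurable_integrable \<phi>) auto
    show "AE t in lebesgue_on {0..1}. norm (g t * \<phi> t) \<le> norm (B * norm (\<phi> t))"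
      by (intro AE_I2) (auto simp: norm_mult abs_mult intro!: mult_right_mono order_trans[OF B])
  qed
qed

text \<open>
  Multiplicative convolution on the unit interval. The weight \<open>\<phi>\<close> is only assumed integrable, since
  \<open>t powr p * (1 - t) powr q\<close> may be unbounded at both end points.
\<close>
definition averaged :: "(complex \<Rightarrow> complex) \<Rightarrow> (real \<Rightarrow> complex) \<Rightarrow> complex \<Rightarrow> complex" where
  "averaged F \<phi> z = (LINT t|lebesgue_on {0..1}. F (z * of_real t) * \<phi> t)"

lemma entire_rescaled_continuous:
  assumes "F holomorphic_on UNIV"
  shows "continuous_on A (\<lambda>t::real. F (z * of_real t))"
  by (intro continuous_on_compose2[OF holomorphic_on_imp_continuous_on[OF assms]] continuous_intros) auto

context
  fixes F :: "complex \<Rightarrow> complex" and \<phi> :: "real \<Rightarrow> complex"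
  assumes hol: "F holomorphic_on UNIV" and \<phi>: "integrable (lebesgue_on {0..1}) \<phi>"
begin

lemma integrable_averaged:
  "integrable (lebesgue_on {0..1}) (\<lambda>t. F (z * of_real t) * \<phi> t)"
  by (intro integrable_continuous_mult entire_rescaled_continuous hol \<phi>)

text \<open>
  Integrating the Taylor series of \<open>F\<close> term by term multiplies the coefficients by the moments of \<open>\<phi>\<close>,
  which are bounded. This yields holomorphy and the derivative at 0 without differentiation under
  the integral sign.
\<close>
lemma averaged_power_series:
  "(\<lambda>k. (deriv ^^ k) F 0 / fact k * (LINT t|lebesgue_on {0..1}. of_real (t ^ k) * \<phi> t) * z ^ k)
     sums averaged F \<phi> z"
proof -
  define c where "c = (\<lambda>k. (deriv ^^ k) F 0 / fact k)"
  have F_sums: "(\<lambda>k. c k * w ^ k) sums F w" for w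
    using holomorphic_power_series[of F 0 "norm w + 1" w] hol
    by (simp add: c_def holomorphic_on_subset)
  have int_k: "integrable (lebesgue_on {0..1}) (\<lambda>t. of_real (t ^ k) * \<phi> t)" for k
    by (intro integrable_continuous_mult \<phi> continuous_intros)
  define f where "f = (\<lambda>k t. c k * z ^ k * (of_real (t ^ k) * \<phi> t))"
  have f_sums: "(\<lambda>k. f k t) sums (F (z * of_real t) * \<phi> t)" for t
    using sums_mult2[OF F_sums[of "z * of_real t"], of "\<phi> t"]
    by (simp add: f_def power_mult_distrib mult_ac)
  have abs_summable: "summable (\<lambda>k. norm (c k * w ^ k))" for w
  proof (rule powser_insidea)
    show "summable (\<lambda>k. c k * of_real (norm w + 1) ^ k)"
      by (rule sums_summable[OF F_sums])
    have "norm w < norm w + 1" by simp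
    also have "\<dots> = norm (of_real (norm w + 1) :: complex)"
      unfolding norm_of_real by simp
    finally show "norm w < norm (of_real (norm w + 1) :: complex)" .
  qed
  have "(\<lambda>k. LINT t|lebesgue_on {0..1}. f k t) sums (LINT t|lebesgue_on {0..1}. (\<Sum>k. f k t))"
  proof (rule sums_integral)
    show "integrable (lebesgue_on {0..1}) (f k)" for k
      unfolding f_def by (intro integrable_mult_right int_k)
    show "AE t in lebesgue_on {0..1}. summable (\<lambda>k. norm (f k t))"
    proof (rule AE_I2)
      fix t
      have "summable (\<lambda>k. norm (c k * (z * of_real t) ^ k) * norm (\<phi> t))"
        by (intro summable_mult2 abs_summable)
      thus "summable (\<lambda>k. norm (f k t))"
        by (simp add: f_def norm_mult norm_power power_mult_distrib mult_ac)
    qed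
    show "summable (\<lambda>k. LINT t|lebesgue_on {0..1}. norm (f k t))"
    proof (rule summable_comparison_test'[where N = 0])
      show "summable (\<lambda>k. norm (c k * z ^ k) * (LINT t|lebesgue_on {0..1}. norm (\<phi> t)))"
        by (intro summable_mult2 abs_summable)
      fix k :: nat
      have "(LINT t|lebesgue_on {0..1}. norm (f k t))
          = norm (c k * z ^ k) * (LINT t|lebesgue_on {0..1}. norm (of_real (t ^ k) * \<phi> t))"
        unfolding f_def norm_mult[of "c k * z ^ k"] by simp
      also have "\<dots> \<le> norm (c k * z ^ k) * (LINT t|lebesgue_on {0..1}. norm (\<phi> t))"
      proof (intro mult_left_mono integral_mono_AE AE_I2)
        fix t :: real assume "t \<in> space (lebesgue_on {0..1})"
        hence "\<bar>t ^ k\<bar> \<le> 1"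
          by (simp add: power_abs power_le_one)
        thus "norm (of_real (t ^ k) * \<phi> t) \<le> norm (\<phi> t)"
          unfolding norm_mult norm_of_real by (intro mult_left_le_one_le) auto
      qed (use integrable_norm[OF int_k[of k]] integrable_norm[OF \<phi>] in auto)
      finally show "norm (LINT t|lebesgue_on {0..1}. norm (f k t))
          \<le> norm (c k * z ^ k) * (LINT t|lebesgue_on {0..1}. norm (\<phi> t))"
        by simp
    qed
  qed
  also have "(LINT t|lebesgue_on {0..1}. (\<Sum>k. f k t)) = averaged F \<phi> z"
    unfolding averaged_def using f_sums by (simp add: sums_iff)
  finally show ?thesis
    unfolding f_def integral_mult_right_zero c_def by (simp add: mult_ac)
qed

lemma averaged_holomorphic: "averaged F \<phi> holomorphic_on A"
  using entire_power_series(1)[OF averaged_power_series] by (rule holomorphic_on_subset) simp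

lemma averaged_at_0: "averaged F \<phi> 0 = F 0 * (LINT t|lebesgue_on {0..1}. \<phi> t)"
  by (simp add: averaged_def)

lemma averaged_deriv_at_0:
  "deriv (averaged F \<phi>) 0 = deriv F 0 * (LINT t|lebesgue_on {0..1}. of_real t * \<phi> t)"
  using entire_power_series(2)[OF averaged_power_series, of 1] by simp

lemma norm_averaged_le:
  assumes "\<And>t. 0 \<le> t \<Longrightarrow> t \<le> 1 \<Longrightarrow> norm (F (z * of_real t)) \<le> B"
  shows "norm (averaged F \<phi> z) \<le> B * (LINT t|lebesgue_on {0..1}. norm (\<phi> t))"
proof -
  have "norm (averaged F \<phi> z) \<le> (LINT t|lebesgue_on {0..1}. norm (F (z * of_real t) * \<phi> t))"
    unfolding averaged_def by (rule integral_norm_bound)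
  also have "\<dots> \<le> (LINT t|lebesgue_on {0..1}. B * norm (\<phi> t))"
  proof (intro integral_mono_AE AE_I2 integrable_mult_right integrable_norm \<phi> integrable_averaged)
    fix t :: real assume "t \<in> space (lebesgue_on {0..1})"
    thus "norm (F (z * of_real t) * \<phi> t) \<le> B * norm (\<phi> t)"
      unfolding norm_mult by (intro mult_right_mono assms) auto
  qed
  finally show ?thesis by simp
qed

lemma averaged_min_exp_type:
  assumes "min_exp_type F"
  shows "min_exp_type (averaged F \<phi>)"
  unfolding min_exp_type_def
proof (intro allI impI)
  fix \<epsilon> :: real assume "\<epsilon> > 0"
  then obtain C where C: "C \<ge> 1" "\<And>z. norm (F z) \<le> C * exp (\<epsilon> * norm z)"
    using min_exp_typeD[OF assms] by blast
  have "norm (averaged F \<phi> z) \<le> C * exp (\<epsilon> * norm z) * (LINT t|lebesgue_on {0..1}. norm (\<phi> t))" for z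
  proof (rule norm_averaged_le)
    fix t :: real assume "0 \<le> t" "t \<le> 1"
    hence "norm (z * of_real t) \<le> norm z"
      by (simp add: norm_mult mult_left_le)
    thus "norm (F (z * of_real t)) \<le> C * exp (\<epsilon> * norm z)"
      using \<open>\<epsilon> > 0\<close> C(1) by (intro order_trans[OF C(2)] mult_left_mono) auto
  qed
  thus "\<exists>C. \<forall>z. norm (averaged F \<phi> z) \<le> C * exp (\<epsilon> * norm z)"
    by (intro exI[of _ "C * (LINT t|lebesgue_on {0..1}. norm (\<phi> t))"]) (simp add: mult_ac)
qed

end

lemma min_exp_type_add:
  assumes "min_exp_type f" "min_exp_type g"
  shows "min_exp_type (\<lambda>z. f z + g z)"
  unfolding min_exp_type_def
proof (intro allI impI)
  fix \<epsilon> :: real assume eps: "\<epsilon> > 0"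
  obtain C where C: "\<And>z. norm (f z) \<le> C * exp (\<epsilon> * norm z)"
    using min_exp_typeD[OF assms(1) eps] by blast
  obtain C' where C': "\<And>z. norm (g z) \<le> C' * exp (\<epsilon> * norm z)"
    using min_exp_typeD[OF assms(2) eps] by blast
  have "norm (f z + g z) \<le> (C + C') * exp (\<epsilon> * norm z)" for z
    using norm_triangle_ineq[of "f z" "g z"] C[of z] C'[of z] by (simp add: distrib_right)
  thus "\<exists>C. \<forall>z. norm (f z + g z) \<le> C * exp (\<epsilon> * norm z)"
    by blast
qed

lemma min_exp_type_id_mult:
  assumes "min_exp_type f"
  shows "min_exp_type (\<lambda>z. z * f z)"
  unfolding min_exp_type_def
proof (intro allI impI)
  fix \<epsilon> :: real assume eps: "\<epsilon> > 0"
  obtain C where C: "C \<ge> 1" "\<And>z. norm (f z) \<le> C * exp (\<epsilon> / 2 * norm z)"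
    using min_exp_typeD[OF assms, of "\<epsilon> / 2"] eps by auto
  have "norm (z * f z) \<le> 2 / \<epsilon> * C * exp (\<epsilon> * norm z)" for z
  proof -
    have "\<epsilon> / 2 * norm z \<le> exp (\<epsilon> / 2 * norm z)"
      using exp_ge_add_one_self[of "\<epsilon> / 2 * norm z"] by linarith
    hence "norm z \<le> 2 / \<epsilon> * exp (\<epsilon> / 2 * norm z)"
      using eps by (simp add: field_simps)
    hence "norm (z * f z) \<le> 2 / \<epsilon> * exp (\<epsilon> / 2 * norm z) * (C * exp (\<epsilon> / 2 * norm z))"
      unfolding norm_mult using C eps by (intro mult_mono) auto
    also have "\<dots> = 2 / \<epsilon> * C * (exp (\<epsilon> / 2 * norm z) * exp (\<epsilon> / 2 * norm z))"
      by simp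
    also have "\<dots> = 2 / \<epsilon> * C * exp (\<epsilon> * norm z)"
      unfolding exp_add[symmetric] by simp
    finally show ?thesis .
  qed
  thus "\<exists>C. \<forall>z. norm (z * f z) \<le> C * exp (\<epsilon> * norm z)"
    by blast
qed

text \<open>
  At a simple zero of \<open>F\<close> where \<open>D\<close> vanishes too, the quotient has the limit \<open>deriv D z / deriv F z\<close>, so
  its singularity is removable.
\<close>
lemma entire_quotient_simple_zeros:
  assumes F: "F holomorphic_on UNIV" "F z0 \<noteq> 0" and D: "D holomorphic_on UNIV"
    and simple: "\<And>z. F z = 0 \<Longrightarrow> deriv F z \<noteq> 0" and vanish: "\<And>z. F z = 0 \<Longrightarrow> D z = 0"
  obtains H where "H holomorphic_on UNIV" "\<And>z. D z = H z * F z"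
proof -
  define q where "q = (\<lambda>z. D z / F z)"
  have deriv: "(G has_field_derivative deriv G z) (at z)" if "G holomorphic_on UNIV" for G z
    using holomorphic_derivI[OF that open_UNIV] by simp
  have "remove_sings q analytic_on {z} \<and> D z = remove_sings q z * F z" for z
  proof (cases "F z = 0")
    case False
    have "q analytic_on {z}"
      unfolding q_def using False F(1) D
      by (intro analytic_intros holomorphic_on_imp_analytic_at[where A = UNIV]) auto
    thus ?thesis
      using False by (simp add: remove_sings_analytic_on remove_sings_at_analytic q_def)
  next
    case True
    have "eventually (\<lambda>w. F w \<noteq> 0) (at z)"
      using non_zero_neighbour_alt[OF F(1) open_UNIV connected_UNIV UNIV_I UNIV_I F(2), of z] by simp
    then obtain r where r: "r > 0" "\<And>w. w \<noteq> z \<Longrightarrow> dist w z < r \<Longrightarrow> F w \<noteq> 0"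
      unfolding eventually_at by auto
    have "q holomorphic_on ball z r - {z}"
      unfolding q_def using r(2)
      by (intro holomorphic_intros holomorphic_on_subset[OF F(1)] holomorphic_on_subset[OF D])
         (auto simp: dist_commute)
    hence "isolated_singularity_at q z"
      using r(1) by (intro isolated_singularity_at_holomorphic[of _ "ball z r"]) auto
    moreover have "(q \<longlongrightarrow> deriv D z / deriv F z) (at z)"
      unfolding q_def
      by (rule lhopital_complex_simple[OF deriv[OF D] deriv[OF F(1)] vanish[OF True] True simple[OF True] refl])
    ultimately have "remove_sings q analytic_on {z}"
      by (rule remove_sings_analytic_at)
    thus ?thesis
      using True vanish[OF True] by simp
  qed
  hence "remove_sings q holomorphic_on UNIV" "\<And>z. D z = remove_sings q z * F z"
    using analytic_on_analytic_at analytic_imp_holomorphic by blast+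
  thus ?thesis
    using that by blast
qed

section \<open>Canonical products with real zeros\<close>

locale genus_zero_real_zeros = genus_zero_zeros +
  assumes real_zeros: "a n \<in> \<real>"
begin

lemma P_real: "P (of_real x) \<in> \<real>"
proof (rule Lim_in_closed_set)
  show "\<forall>\<^sub>F n in sequentially. (\<Prod>k<n. 1 - of_real x / a k) \<in> \<real>"
    by (intro always_eventually allI prod_in_Reals Reals_diff Reals_1 Reals_divide Reals_of_real real_zeros)
qed (use P_limit in \<open>auto intro: closed_complex_Reals\<close>)

text \<open>
  The modulus of the factor \<open>1 - z / a n\<close> at \<open>z = \<i> * y\<close>. For real zeros it increases with \<open>\<bar>y\<bar>\<close>, which is
  why the imaginary axis is the right line on which to compare \<open>P\<close> with its means.
\<close>
definition factor_modulus :: "nat \<Rightarrow> real \<Rightarrow> real" where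
  "factor_modulus n y = sqrt (1 + (y / Re (a n))\<^sup>2)"

lemma Re_a_nonzero: "Re (a n) \<noteq> 0"
  using nonzero[of n] real_zeros[of n] by (auto elim!: Reals_cases)

lemma norm_factor_imaginary: "norm (1 - \<i> * of_real y / a n) = factor_modulus n y"
proof -
  have a: "a n = of_real (Re (a n))"
    using real_zeros[of n] by (auto elim!: Reals_cases)
  have "1 - \<i> * of_real y / a n = Complex 1 (- (y / Re (a n)))"
    by (subst a) (simp add: complex_eq_iff Re_divide_of_real Im_divide_of_real)
  thus ?thesis
    by (simp add: factor_modulus_def cmod_def)
qed

lemma P_imaginary_limit: "(\<lambda>m. \<Prod>n<m. factor_modulus n y) \<longlonglongrightarrow> norm (P (\<i> * of_real y))"
  using tendsto_norm[OF P_limit[of "\<i> * of_real y"]]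
  by (simp add: norm_factor_imaginary flip: prod_norm)

lemma factor_modulus_pos: "factor_modulus n y > 0"
  unfolding factor_modulus_def by (simp add: add_pos_nonneg)

lemma factor_modulus_mono:
  assumes "0 \<le> t" "t \<le> 1"
  shows "factor_modulus n (y * t) \<le> factor_modulus n y"
proof -
  have "(y * t / Re (a n))\<^sup>2 = (y / Re (a n))\<^sup>2 * t\<^sup>2"
    by (simp add: power_mult_distrib power_divide)
  also have "\<dots> \<le> (y / Re (a n))\<^sup>2 * 1"
    using assms by (intro mult_left_mono power_le_one) auto
  finally show ?thesis
    by (simp add: factor_modulus_def)
qed

text \<open>
  Every factor increases along the imaginary axis, so a quotient \<open>P (\<i> * y * t) / P (\<i> * y)\<close> is at most the
  corresponding quotient of any initial partial product, stated without division. The empty partial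
  product gives monotonicity, long ones give decay.
\<close>
lemma P_imaginary_ratio:
  assumes "0 \<le> t" "t \<le> 1"
  shows "norm (P (\<i> * of_real (y * t))) * (\<Prod>n<N. factor_modulus n y) \<le> norm (P (\<i> * of_real y)) * (\<Prod>n<N. factor_modulus n (y * t))"
proof (rule tendsto_le)
  show "(\<lambda>m. (\<Prod>n<m. factor_modulus n (y * t)) * (\<Prod>n<N. factor_modulus n y)) \<longlonglongrightarrow> norm (P (\<i> * of_real (y * t))) * (\<Prod>n<N. factor_modulus n y)"
    by (intro tendsto_mult P_imaginary_limit tendsto_const)
  show "(\<lambda>m. (\<Prod>n<m. factor_modulus n y) * (\<Prod>n<N. factor_modulus n (y * t))) \<longlonglongrightarrow> norm (P (\<i> * of_real y)) * (\<Prod>n<N. factor_modulus n (y * t))"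
    by (intro tendsto_mult P_imaginary_limit tendsto_const)
  show "\<forall>\<^sub>F m in sequentially. (\<Prod>n<m. factor_modulus n (y * t)) * (\<Prod>n<N. factor_modulus n y) \<le> (\<Prod>n<m. factor_modulus n y) * (\<Prod>n<N. factor_modulus n (y * t))"
    using eventually_ge_at_top[of N]
  proof eventually_elim
    case (elim m)
    have split: "(\<Prod>n<m. factor_modulus n x) = (\<Prod>n\<in>{N..<m}. factor_modulus n x) * (\<Prod>n<N. factor_modulus n x)" for x
      using prod.subset_diff[of "{..<N}" "{..<m}" "\<lambda>n. factor_modulus n x"] elim
      by (simp add: lessThan_minus_lessThan)
    have "(\<Prod>n\<in>{N..<m}. factor_modulus n (y * t)) \<le> (\<Prod>n\<in>{N..<m}. factor_modulus n y)"
      using factor_modulus_pos by (intro prod_mono) (auto intro: factor_modulus_mono assms less_imp_le)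
    hence "(\<Prod>n\<in>{N..<m}. factor_modulus n (y * t)) * ((\<Prod>n<N. factor_modulus n (y * t)) * (\<Prod>n<N. factor_modulus n y))
        \<le> (\<Prod>n\<in>{N..<m}. factor_modulus n y) * ((\<Prod>n<N. factor_modulus n (y * t)) * (\<Prod>n<N. factor_modulus n y))"
      using factor_modulus_pos by (intro mult_right_mono mult_nonneg_nonneg prod_nonneg) (auto intro: less_imp_le)
    thus ?case
      by (simp add: split mult_ac)
  qed
qed auto

lemma P_imaginary_mono:
  assumes "0 \<le> t" "t \<le> 1"
  shows "norm (P (\<i> * of_real (y * t))) \<le> norm (P (\<i> * of_real y))"
  using P_imaginary_ratio[OF assms, of y 0] by simp

lemma P_imaginary_ge_1: "norm (P (\<i> * of_real y)) \<ge> 1"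
  using P_imaginary_mono[of 0 y] by (simp add: P_0)

text \<open>
  A single factor contributes the limit \<open>t\<close>, so \<open>N\<close> factors bound the upper limit by \<open>t ^ N\<close>. That there
  are infinitely many zeros is essential.
\<close>
lemma P_imaginary_ratio_tendsto_0:
  assumes "0 \<le> t" "t < 1"
  shows "(\<lambda>j. P (\<i> * of_real (real j * t)) / P (\<i> * of_real (real j))) \<longlonglongrightarrow> 0"
proof (rule tendstoI)
  fix e :: real assume "e > 0"
  then obtain N where N: "t ^ N < e"
    using real_arch_pow_inv assms(2) by blast
  define \<rho> where "\<rho> = (\<lambda>j. \<Prod>n<N. factor_modulus n (real j * t) / factor_modulus n (real j))"
  have "(\<lambda>j. factor_modulus n (real j * t) / factor_modulus n (real j)) \<longlonglongrightarrow> t" for n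
  proof -
    define c where "c = (1 / Re (a n))\<^sup>2"
    have c: "c > 0"
      using Re_a_nonzero[of n] by (simp add: c_def)
    have "(\<lambda>j. sqrt (t\<^sup>2 + (1 - t\<^sup>2) / (1 + c * (real j)\<^sup>2))) \<longlonglongrightarrow> sqrt (t\<^sup>2 + (1 - t\<^sup>2) * 0)"
    proof -
      have "(\<lambda>j. 1 / (1 + c * (real j)\<^sup>2)) \<longlonglongrightarrow> 0"
        using c by real_asymp
      from tendsto_mult[OF tendsto_const[of "1 - t\<^sup>2"] this]
      have "(\<lambda>j. (1 - t\<^sup>2) / (1 + c * (real j)\<^sup>2)) \<longlonglongrightarrow> (1 - t\<^sup>2) * 0"
        by simp
      thus ?thesis
        by (intro tendsto_real_sqrt tendsto_add tendsto_const)
    qed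
    moreover have "factor_modulus n (real j * t) / factor_modulus n (real j) = sqrt (t\<^sup>2 + (1 - t\<^sup>2) / (1 + c * (real j)\<^sup>2))" for j
    proof -
      have "1 + c * (real j)\<^sup>2 > 0"
        using c by (intro add_pos_nonneg) auto
      hence "(1 + c * (real j * t)\<^sup>2) / (1 + c * (real j)\<^sup>2) = t\<^sup>2 + (1 - t\<^sup>2) / (1 + c * (real j)\<^sup>2)"
        by (simp add: field_simps power_mult_distrib)
      moreover have "(y / Re (a n))\<^sup>2 = c * y\<^sup>2" for y
        by (simp add: c_def power_divide)
      ultimately show ?thesis
        by (simp add: factor_modulus_def flip: real_sqrt_divide)
    qed
    ultimately show ?thesis
      using assms(1) by simp
  qed
  hence "\<rho> \<longlonglongrightarrow> (\<Prod>n<N. t)"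
    unfolding \<rho>_def by (intro tendsto_prod)
  hence "eventually (\<lambda>j. \<rho> j < e) sequentially"
    using N by (intro order_tendstoD(2)) auto
  thus "\<forall>\<^sub>F j in sequentially. dist (P (\<i> * of_real (real j * t)) / P (\<i> * of_real (real j))) 0 < e"
  proof eventually_elim
    case (elim j)
    have pos: "(\<Prod>n<N. factor_modulus n (real j)) > 0"
      by (intro prod_pos) (auto intro: factor_modulus_pos)
    have frac: "x / b \<le> d / c" if "x * c \<le> b * d" "b \<ge> 1" "c > 0" for x b c d :: real
      using that by (simp add: field_simps)
    have "norm (P (\<i> * of_real (real j * t))) / norm (P (\<i> * of_real (real j))) \<le> \<rho> j"
      unfolding \<rho>_def prod_dividef
      using assms by (intro frac P_imaginary_ratio P_imaginary_ge_1 pos) auto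
    thus ?case
      using elim by (simp add: norm_divide)
  qed
qed

lemma averaged_ratio_tendsto_0:
  assumes \<phi>: "integrable (lebesgue_on {0..1}) \<phi>"
  shows "(\<lambda>j. averaged P \<phi> (\<i> * of_real (real j)) / P (\<i> * of_real (real j))) \<longlonglongrightarrow> 0"
proof -
  define q where "q = (\<lambda>j t. P (\<i> * of_real (real j) * of_real t) / P (\<i> * of_real (real j)) * \<phi> t)"
  have q_int: "integrable (lebesgue_on {0..1}) (q j)" for j
    using integrable_averaged[OF W.holomorphic \<phi>, of "\<i> * of_real (real j)"]
    by (simp add: q_def)
  have "(\<lambda>j. LINT t|lebesgue_on {0..1}. q j t) \<longlonglongrightarrow> (LINT t|lebesgue_on {0..1::real}. 0)"
  proof (rule integral_dominated_convergence[where w = "\<lambda>t. norm (\<phi> t)"])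
    \<comment> \<open>At \<open>t = 1\<close> the quotient is constantly 1, so that point has to be left out.\<close>
    show "AE t in lebesgue_on {0..1}. (\<lambda>j. q j t) \<longlonglongrightarrow> 0"
    proof (rule AE_I')
      show "{1} \<in> null_sets (lebesgue_on {0..1::real})"
        by (subst null_sets_restrict_space) (auto simp flip: negligible_iff_null_sets)
      have "(\<lambda>j. q j t) \<longlonglongrightarrow> 0" if "t \<in> {0..1}" "t \<noteq> 1" for t
        using tendsto_mult_right[OF P_imaginary_ratio_tendsto_0[of t], of "\<phi> t"] that
        by (simp add: q_def mult_ac)
      thus "{t \<in> space (lebesgue_on {0..1}). \<not> (\<lambda>j. q j t) \<longlonglongrightarrow> 0} \<subseteq> {1}"
        by auto
    qed
    show "AE t in lebesgue_on {0..1}. norm (q j t) \<le> norm (\<phi> t)" for j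
    proof (rule AE_I2)
      fix t :: real assume "t \<in> space (lebesgue_on {0..1})"
      hence "norm (P (\<i> * of_real (real j) * of_real t)) \<le> norm (P (\<i> * of_real (real j)))"
        using P_imaginary_mono[of t "real j"] by (simp add: mult.assoc)
      hence "norm (P (\<i> * of_real (real j) * of_real t)) / norm (P (\<i> * of_real (real j))) \<le> 1"
        using P_imaginary_ge_1[of "real j"] by (simp add: divide_le_eq)
      thus "norm (q j t) \<le> norm (\<phi> t)"
        unfolding q_def norm_mult norm_divide by (intro mult_left_le_one_le) auto
    qed
    show "q j \<in> borel_measurable (lebesgue_on {0..1})" for j
      using q_int by (rule borel_measurable_integrable)
  qed (use \<phi> in auto)
  thus ?thesis
    by (simp add: averaged_def q_def)
qed

text \<open>
  The uniqueness principle: \<open>H = D / P\<close> is entire of minimal exponential type and \<open>O(1 + \<bar>y\<bar>)\<close> on the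
  imaginary axis, so its difference quotient \<open>k\<close> at 0 is bounded there and hence constant. Then \<open>H\<close> is affine, and
  its slope is the limit of \<open>H (\<i> * y) / (\<i> * y)\<close>, which is 0 because the means of \<open>P\<close> are negligible
  against \<open>P\<close> on the imaginary axis.
\<close>
lemma averaged_vanishing_at_zeros:
  assumes met: "min_exp_type P" and simple: "\<And>n. deriv P (a n) \<noteq> 0"
    and \<phi>: "integrable (lebesgue_on {0..1}) \<phi>" and \<psi>: "integrable (lebesgue_on {0..1}) \<psi>"
    and vanish: "\<And>n. a n * averaged P \<phi> (a n) + averaged P \<psi> (a n) = 0"
  shows "z * averaged P \<phi> z + averaged P \<psi> z = (LINT t|lebesgue_on {0..1}. \<psi> t) * P z"
proof -
  define D where "D = (\<lambda>z. z * averaged P \<phi> z + averaged P \<psi> z)"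
  note avg_hol = averaged_holomorphic[OF W.holomorphic]
  note avg_met = averaged_min_exp_type[OF W.holomorphic _ met]
  have D_hol: "D holomorphic_on UNIV"
    unfolding D_def by (intro holomorphic_intros avg_hol \<phi> \<psi>)
  obtain H where H: "H holomorphic_on UNIV" "\<And>z. D z = H z * P z"
  proof (rule entire_quotient_simple_zeros[OF W.holomorphic _ D_hol])
    show "P 0 \<noteq> 0"
      by (simp add: P_0)
    show "deriv P z \<noteq> 0" if "P z = 0" for z
      using that simple by (auto simp: W.zero)
    show "D z = 0" if "P z = 0" for z
      using that vanish by (auto simp: W.zero D_def)
  qed blast
  have "D = (\<lambda>z. H z * P z)"
    using H(2) by blast
  hence HP: "(\<lambda>z. H z * P z) = D"
    by (rule sym)
  have H_met: "min_exp_type H"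
  proof (rule min_exp_type_quotient[OF H(1)])
    show "min_exp_type (\<lambda>z. H z * P z)"
      unfolding HP D_def by (intro min_exp_type_add min_exp_type_id_mult avg_met \<phi> \<psi>)
  qed
  define A B where "A = (LINT t|lebesgue_on {0..1}. norm (\<phi> t))" and "B = (LINT t|lebesgue_on {0..1}. norm (\<psi> t))"
  have H_imag: "norm (H (\<i> * of_real y)) \<le> \<bar>y\<bar> * A + B" for y
  proof -
    have avg: "norm (averaged P \<eta> (\<i> * of_real y)) \<le> norm (P (\<i> * of_real y)) * (LINT t|lebesgue_on {0..1}. norm (\<eta> t))"
      if "integrable (lebesgue_on {0..1}) \<eta>" for \<eta>
      using P_imaginary_mono[of _ y] by (intro norm_averaged_le[OF W.holomorphic that]) (simp add: mult.assoc)
    have "norm (H (\<i> * of_real y)) * norm (P (\<i> * of_real y)) = norm (D (\<i> * of_real y))"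
      by (simp add: H(2) norm_mult)
    also have "\<dots> \<le> \<bar>y\<bar> * norm (averaged P \<phi> (\<i> * of_real y)) + norm (averaged P \<psi> (\<i> * of_real y))"
      unfolding D_def by (rule order_trans[OF norm_triangle_ineq]) (simp add: norm_mult)
    also have "\<dots> \<le> \<bar>y\<bar> * (norm (P (\<i> * of_real y)) * A) + norm (P (\<i> * of_real y)) * B"
      unfolding A_def B_def by (intro add_mono mult_left_mono avg \<phi> \<psi>) auto
    also have "\<dots> = (\<bar>y\<bar> * A + B) * norm (P (\<i> * of_real y))"
      by (simp add: algebra_simps)
    finally show ?thesis
      using P_imaginary_ge_1[of y] by (rule mult_right_le_imp_le[OF _ less_le_trans[OF zero_less_one]])
  qed
  define k where "k = (\<lambda>z. if z = 0 then deriv H 0 else (H z - H 0) / (z - 0))"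
  have k_hol: "k holomorphic_on UNIV"
    unfolding k_def by (rule pole_lemma[OF H(1)]) simp
  have k_cont: "continuous_on A (\<lambda>x. k (\<i> * of_real x))" for A :: "real set"
    by (intro continuous_on_compose2[OF holomorphic_on_imp_continuous_on[OF k_hol]] continuous_intros) auto
  have "k z = k 0" for z
  proof -
    \<comment> \<open>Rotation turns the imaginary axis into the real one.\<close>
    define k' where "k' = (\<lambda>w. k (\<i> * w))"
    have "k' holomorphic_on UNIV"
      unfolding k'_def by (intro holomorphic_on_compose_gen[OF _ k_hol, unfolded o_def] holomorphic_intros) auto
    moreover have "min_exp_type k'"
    proof (rule min_exp_typeI_outside)
      show "continuous_on UNIV k'"
        using \<open>k' holomorphic_on UNIV\<close> by (rule holomorphic_on_imp_continuous_on)
      fix \<epsilon> :: real assume eps: "\<epsilon> > 0"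
      obtain C where C: "C \<ge> 1" "\<And>z. norm (H z) \<le> C * exp (\<epsilon> * norm z)"
        using min_exp_typeD[OF H_met eps] by blast
      have "norm (k' w) \<le> 2 * C * exp (\<epsilon> * norm w)" if w: "norm w \<ge> 1" for w
      proof -
        have "norm (k' w) = norm (H (\<i> * w) - H 0) / norm w"
          using w by (auto simp: k'_def k_def norm_divide norm_mult)
        also have "\<dots> \<le> norm (H (\<i> * w) - H 0) / 1"
          using w by (intro divide_left_mono) auto
        also have "\<dots> \<le> norm (H (\<i> * w)) + norm (H 0)"
          by (simp add: norm_triangle_ineq4)
        also have "\<dots> \<le> C * exp (\<epsilon> * norm w) + C * exp (\<epsilon> * norm w)"
        proof (rule add_mono)
          show "norm (H (\<i> * w)) \<le> C * exp (\<epsilon> * norm w)"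
            using C(2)[of "\<i> * w"] by (simp add: norm_mult)
          have "C * 1 \<le> C * exp (\<epsilon> * norm w)"
            using C(1) eps by (intro mult_left_mono) auto
          thus "norm (H 0) \<le> C * exp (\<epsilon> * norm w)"
            using C(2)[of 0] by simp
        qed
        finally show ?thesis by simp
      qed
      thus "\<exists>C R. \<forall>z. norm z \<ge> R \<longrightarrow> norm (k' z) \<le> C * exp (\<epsilon> * norm z)"
        by blast
    qed
    moreover obtain M where "\<And>x. norm (k' (of_real x)) \<le> M"
    proof -
      have "compact ((\<lambda>x. k (\<i> * of_real x)) ` {-1..1})"
        by (intro compact_continuous_image k_cont) auto
      then obtain B' where "\<forall>w\<in>(\<lambda>x. k (\<i> * of_real x)) ` {-1..1}. norm w \<le> B'"
        using compact_imp_bounded bounded_iff by metis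
      hence B': "norm (k' (of_real x)) \<le> B'" if "\<bar>x\<bar> \<le> 1" for x
        using that by (auto simp: k'_def abs_le_iff)
      have "norm (k' (of_real x)) \<le> A + B + norm (H 0)" if x: "\<bar>x\<bar> > 1" for x
      proof -
        have B_nonneg: "B \<ge> 0"
          by (simp add: B_def)
        have "norm (k' (of_real x)) = norm (H (\<i> * of_real x) - H 0) / \<bar>x\<bar>"
          using x by (auto simp: k'_def k_def norm_divide norm_mult)
        also have "\<dots> \<le> (\<bar>x\<bar> * A + B + norm (H 0)) / \<bar>x\<bar>"
          using norm_triangle_ineq4[of "H (\<i> * of_real x)" "H 0"] H_imag[of x]
          by (intro divide_right_mono) auto
        also have "\<dots> = A + (B + norm (H 0)) / \<bar>x\<bar>"
          using x by (auto simp: add_divide_distrib)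
        also have "\<dots> \<le> A + (B + norm (H 0)) / 1"
          using x B_nonneg by (intro add_left_mono divide_left_mono) auto
        finally show ?thesis by simp
      qed
      hence "norm (k' (of_real x)) \<le> max B' (A + B + norm (H 0))" for x
        using B'[of x] by (cases "\<bar>x\<bar> \<le> 1") (auto simp: le_max_iff_disj)
      thus ?thesis
        using that by blast
    qed
    ultimately have "k' (- \<i> * z) = k' 0"
      by (rule min_exp_type_bounded_on_reals_imp_constant)
    thus ?thesis
      by (simp add: k'_def flip: mult.assoc)
  qed
  moreover have "H z = H 0 + z * k z" for z
    by (simp add: k_def)
  ultimately have H_affine: "H z = H 0 + z * k 0" for z
    by metis
  have "k 0 = 0"
  proof (rule LIMSEQ_unique)
    define w where "w = (\<lambda>j. \<i> * of_real (real j))"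
    have inv: "(\<lambda>j. 1 / w j) \<longlonglongrightarrow> 0"
    proof (rule tendsto_norm_zero_cancel)
      have "(\<lambda>j. 1 / real j) \<longlonglongrightarrow> 0"
        by real_asymp
      thus "(\<lambda>j. norm (1 / w j)) \<longlonglongrightarrow> 0"
        by (simp add: w_def norm_divide norm_mult)
    qed
    have "(\<lambda>j. averaged P \<phi> (w j) / P (w j) + averaged P \<psi> (w j) / P (w j) * (1 / w j) - H 0 * (1 / w j))
        \<longlonglongrightarrow> 0 + 0 * 0 - H 0 * 0"
      using averaged_ratio_tendsto_0[OF \<phi>] averaged_ratio_tendsto_0[OF \<psi>]
      by (intro tendsto_diff tendsto_add tendsto_mult tendsto_const inv) (auto simp: w_def)
    moreover have "eventually (\<lambda>j. averaged P \<phi> (w j) / P (w j) + averaged P \<psi> (w j) / P (w j) * (1 / w j)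
        - H 0 * (1 / w j) = k 0) sequentially"
      using eventually_gt_at_top[of 0]
    proof eventually_elim
      case (elim j)
      have nz: "w j \<noteq> 0" "P (w j) \<noteq> 0"
        using elim P_imaginary_ge_1[of "real j"] by (auto simp: w_def)
      have "averaged P \<phi> (w j) / P (w j) + averaged P \<psi> (w j) / P (w j) * (1 / w j)
          = D (w j) / (w j * P (w j))"
        using nz by (simp add: D_def field_simps)
      also have "\<dots> = H (w j) / w j"
        using nz by (simp add: H(2))
      also have "\<dots> = H 0 * (1 / w j) + k 0"
        using nz H_affine[of "w j"] by (simp add: field_simps)
      finally show ?case
        by simp
    qed
    ultimately show "(\<lambda>_. k 0) \<longlonglongrightarrow> 0"
      using Lim_transform_eventually by fastforce
  qed auto
  hence "H z = H 0"
    using H_affine[of z] by simp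
  moreover have "H 0 = (LINT t|lebesgue_on {0..1}. \<psi> t)"
    using H(2)[of 0] by (simp add: D_def P_0 averaged_at_0[OF W.holomorphic \<psi>])
  ultimately show ?thesis
    using H(2)[of z] by (simp add: D_def)
qed

end

section \<open>Orthogonality with respect to the zeros\<close>

text \<open>
  Links the gauge integral of the statement with the Lebesgue integral. The end points are exempt since
  the powers of \<open>u\<close> and \<open>z - u\<close> have meaningless values there.
\<close>
lemma integral_eq_LINT:
  fixes h :: "real \<Rightarrow> complex"
  assumes h: "integrable (lebesgue_on {0..1}) h" and eq: "\<And>t. 0 < t \<Longrightarrow> t < 1 \<Longrightarrow> g t = h t"
  shows "integral {0..1} g = (LINT t|lebesgue_on {0..1}. h t)"
proof -
  have "integral {0..1} g = integral {0..1} h"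
    by (rule integral_spike[of "{0, 1}"]) (auto simp: eq)
  also have "\<dots> = (LINT t|lebesgue_on {0..1}. h t)"
    using h by (intro lebesgue_integral_eq_integral[symmetric]) auto
  finally show ?thesis .
qed

lemma beta_weight_integral:
  assumes "p > -1" "q > -1"
  shows "integrable (lebesgue_on {0..1}) (\<lambda>t::real. t powr p * (1 - t) powr q)"
    and "(LINT t|lebesgue_on {0..1}. t powr p * (1 - t) powr q) = Beta (p + 1) (q + 1)"
proof -
  have has: "((\<lambda>t. t powr p * (1 - t) powr q) has_integral Beta (p + 1) (q + 1)) {0..1}"
    using has_integral_Beta_real[of "p + 1" "q + 1"] assms by simp
  hence "(\<lambda>t. t powr p * (1 - t) powr q) absolutely_integrable_on {0..1}"
    by (intro nonnegative_absolutely_integrable_1) (auto simp: has_integral_integrable)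
  thus int: "integrable (lebesgue_on {0..1}) (\<lambda>t::real. t powr p * (1 - t) powr q)"
    by (simp add: set_integrable_def integrable_restrict_space)
  show "(LINT t|lebesgue_on {0..1}. t powr p * (1 - t) powr q) = Beta (p + 1) (q + 1)"
    using lebesgue_integral_eq_integral[OF int] has by (simp add: integral_unique)
qed

lemma averaged_cmult: "averaged F (\<lambda>t. c * \<phi> t) z = c * averaged F \<phi> z"
proof -
  have "averaged F (\<lambda>t. c * \<phi> t) z = (LINT t|lebesgue_on {0..1}. c * (F (z * of_real t) * \<phi> t))"
    unfolding averaged_def by (simp add: mult_ac)
  thus ?thesis
    by (simp only: averaged_def integral_mult_right_zero)
qed

lemma averaged_diff:
  assumes "F holomorphic_on UNIV" "integrable (lebesgue_on {0..1}) \<phi>" "integrable (lebesgue_on {0..1}) \<psi>"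
  shows "averaged F (\<lambda>t. \<phi> t - \<psi> t) z = averaged F \<phi> z - averaged F \<psi> z"
  unfolding averaged_def right_diff_distrib
  by (intro Bochner_Integration.integral_diff integrable_averaged assms)

lemma branch_pow_add: "branch_pow L (r + s) z = branch_pow L r z * branch_pow L s z"
  by (simp add: branch_pow_def distrib_right exp_add)

lemma branch_pow_nonzero: "branch_pow L s z \<noteq> 0"
  by (simp add: branch_pow_def)

lemma branch_pow_1:
  assumes "log_branch L" "z \<noteq> 0"
  shows "branch_pow L 1 z = z"
  using assms by (simp add: branch_pow_def log_branch_def)

lemma integrable_of_real_weight:
  "integrable (lebesgue_on {0..1}) w \<Longrightarrow> integrable (lebesgue_on {0..1}) (\<lambda>t. complex_of_real (w t))"
  by simp

text \<open>
  On the segment \<open>u = z * t\<close> the powers scale to \<open>z\<close>-powers times real powers of \<open>t\<close> and \<open>1 - t\<close>; the last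
  factor \<open>z\<close> is the derivative of the path, which raises the exponent of \<open>z\<close> by 1.
\<close>
lemma contour_integral_ray:
  assumes L: "log_branch L" and z: "z \<noteq> 0" and F: "F holomorphic_on UNIV"
    and f: "\<And>u. u \<noteq> 0 \<Longrightarrow> f u = branch_pow L \<nu> u * F u"
    and p: "s + \<nu> > -1" and q: "\<beta> > -1"
  shows "contour_integral (linepath 0 z) (\<lambda>u. branch_pow L s u * branch_pow L \<beta> (z - u) * f u)
    = branch_pow L (s + \<beta> + \<nu> + 1) z
      * averaged F (\<lambda>t. of_real (t powr (s + \<nu>) * (1 - t) powr \<beta>)) z"
proof -
  define W where "W = (\<lambda>t. complex_of_real (t powr (s + \<nu>) * (1 - t) powr \<beta>))"
  have W: "integrable (lebesgue_on {0..1}) W"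
    unfolding W_def by (intro integrable_of_real_weight beta_weight_integral p q)
  define c where "c = branch_pow L (s + \<beta> + \<nu> + 1) z"
  have c: "c = branch_pow L s z * branch_pow L \<beta> z * branch_pow L \<nu> z * z"
    by (simp add: c_def branch_pow_add branch_pow_1[OF L z])
  have "contour_integral (linepath 0 z) (\<lambda>u. branch_pow L s u * branch_pow L \<beta> (z - u) * f u)
    = (LINT t|lebesgue_on {0..1}. c * (F (z * of_real t) * W t))"
    unfolding contour_integral_integral
  proof (rule integral_eq_LINT)
    show "integrable (lebesgue_on {0..1}) (\<lambda>t. c * (F (z * of_real t) * W t))"
      by (intro integrable_mult_right integrable_averaged F W)
    fix t :: real assume t: "0 < t" "t < 1"
    have lin: "linepath 0 z t = z * of_real t"
      by (simp add: linepath_def scaleR_conv_of_real mult.commute)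
    have "z - z * of_real t = z * of_real (1 - t)"
      by (simp add: algebra_simps)
    hence beta: "branch_pow L \<beta> (z - z * of_real t) = branch_pow L \<beta> z * of_real ((1 - t) powr \<beta>)"
      using branch_pow_scale[OF L z, of "1 - t"] t by simp
    have "f (z * of_real t) = branch_pow L \<nu> z * of_real (t powr \<nu>) * F (z * of_real t)"
      using f[of "z * of_real t"] branch_pow_scale[OF L z t(1)] z t by simp
    thus "branch_pow L s (linepath 0 z t) * branch_pow L \<beta> (z - linepath 0 z t) * f (linepath 0 z t)
        * vector_derivative (linepath 0 z) (at t) = c * (F (z * of_real t) * W t)"
      unfolding lin beta c W_def branch_pow_scale[OF L z t(1)] by (simp add: powr_add mult_ac)
  qed
  thus ?thesis
    by (simp only: integral_mult_right_zero averaged_def c_def W_def)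
qed

theorem theorem1:
  fixes \<nu> \<alpha> \<beta> :: real
    and L f F :: "complex \<Rightarrow> complex"
    and zs :: "nat \<Rightarrow> complex"
    and a A :: complex
  assumes "\<alpha> > -1 - 2 * \<nu>" and "\<beta> > -1"
    and "log_branch L"
    and "class_B L \<nu> f F zs"
    and orth: "\<And>n m. n \<noteq> m \<Longrightarrow>
      integral {0..1} (\<lambda>t::real. f (zs n * of_real t) * f (zs m * of_real t)
                               * of_real (t powr \<alpha> * (1 - t) powr \<beta>)) = 0"
    and a_def: "a = deriv F 0"
    and A_def: "A = - of_real (Beta (2 * \<nu> + \<alpha> + 1) (\<beta> + 1))"
  shows "\<forall>z. z \<noteq> 0 \<longrightarrow>
     a * contour_integral (linepath 0 z)
           (\<lambda>u. branch_pow L (\<nu> + \<alpha> + 1) u * branch_pow L \<beta> (z - u) * f u)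
     = (a * z + 1) * contour_integral (linepath 0 z)
           (\<lambda>u. branch_pow L (\<nu> + \<alpha>) u * branch_pow L \<beta> (z - u) * f u)
       + branch_pow L (\<nu> + \<alpha> + \<beta> + 1) z * f z * A"
proof -
  note L = \<open>log_branch L\<close>
  have f: "f u = branch_pow L \<nu> u * F u" if "u \<noteq> 0" for u
    using assms(4) that by (simp add: class_B_def)
  have F: "F holomorphic_on UNIV" and F0: "F 0 = 1" and zeros: "enumerates_zeros F zs"
    and growth: "entire_order F < 1 \<or> entire_order F = 1 \<and> entire_type 1 F = 0"
    and real: "\<And>n. zs n \<in> \<real>" and summ: "summable (\<lambda>n. inverse (norm (zs n)))"
    using assms(4) by (auto simp: class_B_def)
  have F_ana: "F analytic_on {z}" for z
    using F by (intro holomorphic_on_imp_analytic_at[where A = UNIV]) auto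
  have F_zs: "F (zs n) = 0" for n
  proof (rule ccontr)
    assume "F (zs n) \<noteq> 0"
    hence "zorder F (zs n) = 0"
      by (intro zorder_eq_0I F_ana)
    hence "card {m. zs m = zs n} = 0" "finite {m. zs m = zs n}"
      using zeros unfolding enumerates_zeros_def by (metis of_nat_eq_0_iff)+
    thus False
      by auto
  qed
  interpret genus_zero_real_zeros zs
  proof
    show "zs n \<noteq> 0" for n
      using F_zs[of n] F0 by auto
  qed (fact real summ)+
  have met: "min_exp_type F"
    using F growth by (rule order_type_imp_min_exp_type)
  have FP: "F = P"
    using F F0 met zeros by (rule hadamard_genus_zero)
  define w where "w = (\<lambda>t::real. t powr (2 * \<nu> + \<alpha>) * (1 - t) powr \<beta>)"
  define W where "W = (\<lambda>t. complex_of_real (w t))"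
  have w_int: "integrable (lebesgue_on {0..1}) w"
    unfolding w_def using assms(1,2) by (intro beta_weight_integral) auto
  have W_int: "integrable (lebesgue_on {0..1}) W"
    unfolding W_def by (intro integrable_of_real_weight w_int)
  have LINT_W: "(LINT t|lebesgue_on {0..1}. W t) = - A"
    unfolding W_def w_def A_def using assms(1,2) beta_weight_integral(2)[of "2 * \<nu> + \<alpha>" \<beta>]
    by (simp add: add.assoc del: of_real_mult)
  define \<phi> where "\<phi> = (\<lambda>n t. F (zs n * of_real t) * W t)"
  have \<phi>_int: "integrable (lebesgue_on {0..1}) (\<phi> n)" for n
    unfolding \<phi>_def by (intro integrable_averaged F W_int)
  have orth': "averaged F (\<phi> n) (zs m) = 0" if "n \<noteq> m" for n m
  proof -
    define c where "c = branch_pow L \<nu> (zs n) * branch_pow L \<nu> (zs m)"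
    have "0 = (LINT t|lebesgue_on {0..1}. c * (F (zs m * of_real t) * \<phi> n t))"
      unfolding orth[OF that, symmetric]
    proof (rule integral_eq_LINT)
      show "integrable (lebesgue_on {0..1}) (\<lambda>t. c * (F (zs m * of_real t) * \<phi> n t))"
        by (intro integrable_mult_right integrable_averaged F \<phi>_int)
      fix t :: real assume t: "0 < t" "t < 1"
      have f_ray: "f (zs k * of_real t) = branch_pow L \<nu> (zs k) * of_real (t powr \<nu>) * F (zs k * of_real t)" for k
        using f[of "zs k * of_real t"] branch_pow_scale[OF L nonzero t(1)] nonzero t by simp
      have "t powr (2 * \<nu> + \<alpha>) = t powr \<nu> * t powr \<nu> * t powr \<alpha>"
        by (simp flip: powr_add)
      thus "f (zs n * of_real t) * f (zs m * of_real t) * of_real (t powr \<alpha> * (1 - t) powr \<beta>)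
          = c * (F (zs m * of_real t) * \<phi> n t)"
        unfolding f_ray c_def \<phi>_def W_def w_def by (simp add: mult_ac)
    qed
    thus ?thesis
      by (simp add: averaged_def c_def branch_pow_nonzero)
  qed
  \<comment> \<open>A repeated zero would make the nonnegative function \<open>r\<^sup>2 * w\<close> have integral 0, but it is positive near 0.\<close>
  have inj: "zs n \<noteq> zs m" if "n \<noteq> m" for n m
  proof
    assume eq: "zs n = zs m"
    obtain l where l: "zs n = of_real l"
      using real[of n] by (auto elim: Reals_cases)
    define r where "r = (\<lambda>t. Re (F (zs n * of_real t)))"
    have F_r: "F (zs n * of_real t) = of_real (r t)" for t
      using P_real[of "l * t"] by (auto simp: FP r_def l elim: Reals_cases)
    have "integrable (lebesgue_on {0..1}) (\<lambda>t. F (zs n * of_real t) * \<phi> n t)"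
      by (intro integrable_averaged F \<phi>_int)
    hence "integrable (lebesgue_on {0..1}) (\<lambda>t. complex_of_real ((r t)\<^sup>2 * w t))"
      unfolding \<phi>_def F_r W_def by (simp add: power2_eq_square mult_ac)
    hence int: "integrable (lebesgue_on {0..1}) (\<lambda>t. (r t)\<^sup>2 * w t)"
      by (subst (asm) complex_of_real_integrable_eq)
    have "complex_of_real (LINT t|lebesgue_on {0..1}. (r t)\<^sup>2 * w t)
        = (LINT t|lebesgue_on {0..1}. complex_of_real ((r t)\<^sup>2 * w t))"
      by (rule integral_complex_of_real[symmetric])
    also have "\<dots> = averaged F (\<phi> n) (zs m)"
      unfolding averaged_def eq[symmetric] \<phi>_def F_r W_def by (simp add: power2_eq_square mult_ac)
    also have "\<dots> = 0"
      by (rule orth'[OF that])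
    finally have "(LINT t|lebesgue_on {0..1}. (r t)\<^sup>2 * w t) = 0"
      by simp
    hence "AE t in lebesgue_on {0..1}. (r t)\<^sup>2 * w t = 0"
      by (subst (asm) integral_nonneg_eq_0_iff_AE[OF int]) (auto simp: w_def)
    hence ae: "AE t in lebesgue. t \<in> {0..1} \<longrightarrow> (r t)\<^sup>2 * w t = 0"
      by (subst (asm) AE_restrict_space_iff) auto
    have "continuous_on UNIV r"
      unfolding r_def by (intro continuous_intros entire_rescaled_continuous F)
    hence "isCont r 0"
      by (simp add: continuous_on_eq_continuous_at)
    moreover have "r 0 \<noteq> 0"
      by (simp add: r_def F0)
    ultimately obtain d where d: "d > 0" "\<And>t. \<bar>t\<bar> < d \<Longrightarrow> r t \<noteq> 0"
      using continuous_at_avoid[of 0 r 0] by (auto simp: dist_norm)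
    define U where "U = {0<..<min d 1}"
    have "AE t in lebesgue. t \<notin> U"
      using ae
    proof eventually_elim
      case (elim t)
      thus ?case
        using d(2)[of t] by (auto simp: U_def w_def)
    qed
    hence "U \<in> null_sets lebesgue"
      by (subst AE_iff_null_sets) (auto simp: U_def)
    hence "negligible U"
      by (simp add: negligible_iff_null_sets)
    moreover have "\<not> negligible U"
      using d(1) by (intro open_not_negligible) (auto simp: U_def)
    ultimately show False
      by contradiction
  qed
  have simple: "deriv F (zs n) \<noteq> 0" for n
  proof
    assume d0: "deriv F (zs n) = 0"
    have "zorder F (zs n) \<ge> int 2"
    proof (rule zorder_geI[OF F_ana F open_UNIV connected_UNIV UNIV_I UNIV_I])
      show "F 0 \<noteq> 0"
        by (simp add: F0)
      show "(deriv ^^ k) F (zs n) = 0" if "k < 2" for k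
        using that d0 F_zs[of n] by (auto simp: less_2_cases_iff)
    qed
    moreover have "{m. zs m = zs n} = {n}"
      using inj by blast
    hence "zorder F (zs n) = 1"
      using zeros unfolding enumerates_zeros_def
      by (metis card.empty card.insert empty_iff finite.emptyI of_nat_1 One_nat_def)
    ultimately show False
      by simp
  qed
  note master = averaged_vanishing_at_zeros[folded FP, OF met simple]
  define K0 K1 where "K0 = averaged F W" and "K1 = averaged F (\<lambda>t. of_real t * W t)"
  have tW_int: "integrable (lebesgue_on {0..1}) (\<lambda>t. of_real t * W t)"
    by (intro integrable_continuous_mult W_int continuous_intros)
  have at_zeros: "a * zs n * K1 (zs n) = (a * zs n + 1) * K0 (zs n)" for n
  proof -
    define g where "g = averaged F (\<phi> n)"
    have C: "(LINT t|lebesgue_on {0..1}. \<phi> n t) = K0 (zs n)"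
      by (simp add: K0_def averaged_def \<phi>_def)
    \<comment> \<open>The factor \<open>1 - z / zs n\<close> supplies the missing zero at \<open>zs n\<close> itself.\<close>
    have g_eq: "(1 - z / zs n) * g z = K0 (zs n) * F z" for z
    proof -
      have "z * averaged F (\<lambda>t. - (1 / zs n) * \<phi> n t) z + averaged F (\<phi> n) z = K0 (zs n) * F z"
        unfolding C[symmetric]
      proof (rule master)
        fix m
        show "zs m * averaged F (\<lambda>t. - (1 / zs n) * \<phi> n t) (zs m) + averaged F (\<phi> n) (zs m) = 0"
          unfolding averaged_cmult using orth'[of n m] nonzero[of n] by (cases "n = m") auto
      qed (intro integrable_mult_right \<phi>_int)+
      thus ?thesis
        unfolding averaged_cmult g_def by (simp add: algebra_simps)
    qed
    have "g holomorphic_on UNIV"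
      unfolding g_def by (intro averaged_holomorphic F \<phi>_int)
    hence dg: "(g has_field_derivative deriv g 0) (at 0)"
      using holomorphic_derivI[OF _ open_UNIV] by blast
    have dF: "(F has_field_derivative a) (at 0)"
      unfolding a_def using holomorphic_derivI[OF F open_UNIV] by blast
    \<comment> \<open>Comparison of the coefficients of \<open>z\<close> on both sides of \<open>g_eq\<close>.\<close>
    have "((\<lambda>z. (1 - z / zs n) * g z) has_field_derivative (deriv g 0 - g 0 / zs n)) (at 0)"
      using nonzero[of n] by (auto intro!: derivative_eq_intros dg)
    moreover have "((\<lambda>z. (1 - z / zs n) * g z) has_field_derivative K0 (zs n) * a) (at 0)"
      unfolding g_eq by (intro DERIV_cmult dF)
    ultimately have "deriv g 0 - g 0 / zs n = K0 (zs n) * a"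
      by (rule DERIV_unique)
    moreover have "g 0 = K0 (zs n)"
      unfolding g_def averaged_at_0[OF F \<phi>_int] C by (simp add: F0)
    moreover have "deriv g 0 = a * K1 (zs n)"
    proof -
      have "(LINT t|lebesgue_on {0..1}. of_real t * \<phi> n t) = K1 (zs n)"
        by (simp add: K1_def averaged_def \<phi>_def mult_ac)
      thus ?thesis
        unfolding g_def averaged_deriv_at_0[OF F \<phi>_int] a_def by simp
    qed
    ultimately show ?thesis
      using nonzero[of n] by (simp add: field_simps)
  qed
  have K_eq: "a * z * K1 z - (a * z + 1) * K0 z = A * F z" for z
  proof -
    \<comment> \<open>The weights that put \<open>a * u * K1 u - (a * u + 1) * K0 u\<close> into the form required by \<open>master\<close>.\<close>
    have expand: "u * averaged F (\<lambda>t. a * (of_real t * W t) - a * W t) u + averaged F (\<lambda>t. - 1 * W t) u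
        = a * u * K1 u - (a * u + 1) * K0 u" for u
      unfolding K0_def K1_def
      by (subst averaged_diff[OF F integrable_mult_right[OF tW_int] integrable_mult_right[OF W_int]])
         (unfold averaged_cmult, simp add: algebra_simps)
    have "z * averaged F (\<lambda>t. a * (of_real t * W t) - a * W t) z + averaged F (\<lambda>t. - 1 * W t) z
        = (LINT t|lebesgue_on {0..1}. - 1 * W t) * F z"
    proof (rule master)
      fix n
      show "zs n * averaged F (\<lambda>t. a * (of_real t * W t) - a * W t) (zs n) + averaged F (\<lambda>t. - 1 * W t) (zs n) = 0"
        unfolding expand at_zeros by simp
    qed (intro Bochner_Integration.integrable_diff integrable_mult_right tW_int W_int)+
    thus ?thesis
      unfolding expand by (simp add: LINT_W)
  qed
  show ?thesis
  proof (intro allI impI)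
    fix z :: complex assume z: "z \<noteq> 0"
    define c where "c = branch_pow L (2 * \<nu> + \<alpha> + \<beta> + 1) z"
    have I0: "contour_integral (linepath 0 z) (\<lambda>u. branch_pow L (\<nu> + \<alpha>) u * branch_pow L \<beta> (z - u) * f u)
        = c * K0 z"
    proof -
      have exponents: "\<nu> + \<alpha> + \<nu> = 2 * \<nu> + \<alpha>" "\<nu> + \<alpha> + \<beta> + \<nu> + 1 = 2 * \<nu> + \<alpha> + \<beta> + 1"
        by simp_all
      have "contour_integral (linepath 0 z) (\<lambda>u. branch_pow L (\<nu> + \<alpha>) u * branch_pow L \<beta> (z - u) * f u)
        = branch_pow L (\<nu> + \<alpha> + \<beta> + \<nu> + 1) z
          * averaged F (\<lambda>t. of_real (t powr (\<nu> + \<alpha> + \<nu>) * (1 - t) powr \<beta>)) z"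
        using assms(1,2) by (intro contour_integral_ray[OF L z F f]) auto
      thus ?thesis
        unfolding exponents c_def K0_def W_def w_def .
    qed
    have I1: "contour_integral (linepath 0 z) (\<lambda>u. branch_pow L (\<nu> + \<alpha> + 1) u * branch_pow L \<beta> (z - u) * f u)
        = c * z * K1 z"
    proof -
      have "averaged F (\<lambda>t. of_real (t powr (\<nu> + \<alpha> + 1 + \<nu>) * (1 - t) powr \<beta>)) z = K1 z"
        unfolding averaged_def K1_def
      proof (intro Bochner_Integration.integral_cong refl)
        fix t :: real assume "t \<in> space (lebesgue_on {0..1})"
        hence "t powr (\<nu> + \<alpha> + 1 + \<nu>) = t * t powr (2 * \<nu> + \<alpha>)"
          by (cases "t = 0") (simp_all add: powr_mult_base add_ac)
        thus "F (z * of_real t) * of_real (t powr (\<nu> + \<alpha> + 1 + \<nu>) * (1 - t) powr \<beta>)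
            = F (z * of_real t) * (of_real t * W t)"
          by (simp add: W_def w_def)
      qed
      moreover have "\<nu> + \<alpha> + 1 + \<beta> + \<nu> + 1 = (2 * \<nu> + \<alpha> + \<beta> + 1) + 1"
        by simp
      hence "branch_pow L (\<nu> + \<alpha> + 1 + \<beta> + \<nu> + 1) z = c * z"
        by (simp only: branch_pow_add[of L "2 * \<nu> + \<alpha> + \<beta> + 1" 1] branch_pow_1[OF L z] c_def)
      ultimately show ?thesis
        using contour_integral_ray[OF L z F f, of "\<nu> + \<alpha> + 1" \<beta>] assms(1,2) by simp
    qed
    have "branch_pow L (\<nu> + \<alpha> + \<beta> + 1) z * f z * A = c * (A * F z)"
    proof -
      have "2 * \<nu> + \<alpha> + \<beta> + 1 = (\<nu> + \<alpha> + \<beta> + 1) + \<nu>"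
        by simp
      hence "c = branch_pow L (\<nu> + \<alpha> + \<beta> + 1) z * branch_pow L \<nu> z"
        unfolding c_def by (simp only: branch_pow_add[of L "\<nu> + \<alpha> + \<beta> + 1" \<nu>])
      thus ?thesis
        by (simp add: f[OF z] mult_ac)
    qed
    thus "a * contour_integral (linepath 0 z) (\<lambda>u. branch_pow L (\<nu> + \<alpha> + 1) u * branch_pow L \<beta> (z - u) * f u)
     = (a * z + 1) * contour_integral (linepath 0 z) (\<lambda>u. branch_pow L (\<nu> + \<alpha>) u * branch_pow L \<beta> (z - u) * f u)
       + branch_pow L (\<nu> + \<alpha> + \<beta> + 1) z * f z * A"
      unfolding I0 I1 K_eq[symmetric] by (simp add: algebra_simps)
  qed
qed

end
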